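(* Consider a system given by $$\begin{aligned} \dot z&=f_0(z,\xi_{1,1},\xi_{2,1},\dots,\xi_{m,1})+p_0(z,w),\\ \dot\xi_{i,j}&=\xi_{i,j+1}+\sum_{l=1}^{i-1}\delta_{i,j,l}(z,\xi)v_l+p_{i,j}(z,\xi,w),\quad j=1,\dots,q_i-1,\\ \dot\xi_{i,q_i}&=v_i+p_{i,q_i}(z,\xi,w),\qquad y_i=\xi_{i,1},\qquad i=1,\dots,m, \end{aligned}$$ where $\xi=\mathrm{col}\{\xi_1,\dots,\xi_m\}$, $\xi_i=\mathrm{col}\{\xi_{i,1},\dots,\xi_{i,q_i}\}$ with scalar $\xi_{i,j}$, $q_1\le q_2\le\dots\le q_m$, $\delta_{i,j,l}=0$ for $j<q_l$, $i=1,\dots,m$, and the functions $f_0$, $p_0$, $\delta_{i,j,l}$ and $p_{i,j}$, $j=1,\dots,q_i$, $i=1,\dots,m$, are smooth with $f_0(0,0,\dots,0)=0$. Assume that $$\|p_0(z,w)\|\le R_0(z)\|w\|\ \ \forall z,w,\qquad |p_{i,j}(z,\xi,w)|\le R_{i,j}(z,\xi)\|w\|\ \ \forall z,\xi,w,\ j=1,\dots,q_i,\ i=1,\dots,m,$$ for some smooth functions $R_0(z)$ and $R_{i,j}(z,\xi)$. Suppose that: 1) there exist a number $\gamma>0$, smooth functions $\phi_{i,1}(z)$ with $\phi_{i,1}(0)=0$, $i=1,\dots,m$, a smooth positive definite and radially unbounded function $V(z)$, and a class $\mathcal K_\infty$ function $\alpha_0(\cdot)$ such that, for all $z$ and $w$,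 $$\frac{\partial V}{\partial z}\bigl[f_0(z,\phi_{1,1}(z),\dots,\phi_{m,1}(z))+p_0(z,w)\bigr]\le-\alpha_0(\|z\|)+\gamma^2\|w\|^2-\|\mathrm{col}\{\phi_{1,1}(z),\dots,\phi_{m,1}(z)\}\|^2;$$ 2) the functions $\delta_{i,j,l}(z,\xi)$ and $p_{i,j}(z,\xi,\cdot)$ depend only on $z$ and on variables $\xi_{\ell_{\rm p},\ell_{\rm b}}$ with (a) $1\le\ell_{\rm p}\le m$ and $\ell_{\rm b}=1$; or (b) $\ell_{\rm b}\le j-1$; or (c) $\ell_{\rm b}=j$ and $\ell_{\rm p}\le i$. Then, for every $\epsilon>0$, there exist smooth feedback laws $v_i=v_i(z,\xi)$, $i=1,\dots,m$, such that the resulting closed-loop system is strictly dissipative with respect to the supply rate $q(w,y)=(\gamma+\epsilon)^2\|w\|^2-\|y\|^2$, where $y=\mathrm{col}\{y_1,\dots,y_m\}$.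
   Context: $\mathrm{col}\{\cdot\}$ denotes vertical stacking; $z$ is a vector in some Euclidean space, $v=(v_1,\dots,v_m)$ is the control input, $w\in\mathbb R$ is the disturbance. A class $\mathcal K_\infty$ function is a continuous strictly increasing unbounded $\alpha:[0,\infty)\to[0,\infty)$ with $\alpha(0)=0$. A closed-loop system $\dot x=F(x,w)$, $y=h(x)$ is strictly dissipative with respect to a supply rate $q(w,y)$ if there exist a smooth, positive definite, proper (radially unbounded) function $W(x)$ and a class $\mathcal K_\infty$ function $\alpha$ such that $\frac{\partial W}{\partial x}F(x,w)\le-\alpha(\|x\|)+q(w,h(x))$ for all $x$ and $w$. *)

theory Defs
  imports "HOL-Analysis.Analysis"
begin

text \<open>
  On finite-dimensional spaces, \<open>f\<close> is of class \<open>C\<^sup>k\<^sup>+\<^sup>1\<close> iff it is differentiable and all its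
  directional derivatives are of class \<open>C\<^sup>k\<close>.
\<close>

primrec times_cont_diff :: "nat \<Rightarrow> ('a::euclidean_space \<Rightarrow> 'b::euclidean_space) \<Rightarrow> bool" where
  "times_cont_diff 0 f \<longleftrightarrow> continuous_on UNIV f"
| "times_cont_diff (Suc k) f \<longleftrightarrow>
     f differentiable_on UNIV \<and> (\<forall>u. times_cont_diff k (\<lambda>x. frechet_derivative f (at x) u))"

definition smooth :: "('a::euclidean_space \<Rightarrow> 'b::euclidean_space) \<Rightarrow> bool" where
  "smooth f \<longleftrightarrow> (\<forall>k. times_cont_diff k f)"

definition class_K_inf :: "(real \<Rightarrow> real) \<Rightarrow> bool" where
  "class_K_inf \<alpha> \<longleftrightarrow>
     continuous_on {0..} \<alpha> \<and> strict_mono_on {0..} \<alpha> \<and> \<not> bdd_above (\<alpha> ` {0..}) \<and> \<alpha> 0 = 0"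

definition positive_definite :: "('a::real_normed_vector \<Rightarrow> real) \<Rightarrow> bool" where
  "positive_definite V \<longleftrightarrow> V 0 = 0 \<and> (\<forall>x. x \<noteq> 0 \<longrightarrow> V x > 0)"

definition radially_unbounded :: "('a::real_normed_vector \<Rightarrow> real) \<Rightarrow> bool" where
  "radially_unbounded V \<longleftrightarrow> filterlim V at_top at_infinity"

definition strictly_dissipative ::
  "('x::euclidean_space \<Rightarrow> 'w \<Rightarrow> 'x) \<Rightarrow> ('x \<Rightarrow> 'y) \<Rightarrow> ('w \<Rightarrow> 'y \<Rightarrow> real) \<Rightarrow> bool" where
  "strictly_dissipative F h s \<longleftrightarrow>
     (\<exists>W \<alpha>. smooth W \<and> positive_definite W \<and> radially_unbounded W \<and> class_K_inf \<alpha> \<and>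
        (\<forall>x w. frechet_derivative W (at x) (F x w) \<le> - \<alpha> (norm x) + s w (h x)))"

text \<open>
  The channels \<open>1, \<dots>, m\<close> are the elements of a finite linearly ordered type \<open>'m\<close>. As the blocks
  \<open>\<xi>\<^sub>i\<close> have different lengths \<open>q i\<close>, the stacked vector \<open>\<xi>\<close> lives in \<open>real ^ 'k\<close>, where \<open>'k\<close> is put
  in bijection with the pairs \<open>(i, j)\<close>, \<open>1 \<le> j \<le> q i\<close>, by \<open>ix\<close>; so \<open>\<xi>\<^sub>i\<^sub>,\<^sub>j\<close> is \<open>\<xi> $ ix i j\<close>.
\<close>

definition block_indexing :: "('m::finite \<Rightarrow> nat) \<Rightarrow> ('m \<Rightarrow> nat \<Rightarrow> 'k::finite) \<Rightarrow> bool" where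
  "block_indexing q ix \<longleftrightarrow> bij_betw (\<lambda>(i, j). ix i j) (SIGMA i:UNIV. {1..q i}) UNIV"

definition stack :: "('m::finite \<Rightarrow> nat) \<Rightarrow> ('m \<Rightarrow> nat \<Rightarrow> 'k::finite) \<Rightarrow> ('m \<Rightarrow> nat \<Rightarrow> real) \<Rightarrow> real ^ 'k"
  where "stack q ix a = (\<Sum>i\<in>UNIV. \<Sum>j=1..q i. a i j *\<^sub>R axis (ix i j) 1)"

lemma stack_nth:
  assumes "block_indexing q ix" "1 \<le> j" "j \<le> q i"
  shows "stack q ix a $ ix i j = a i j"
proof -
  let ?S = "SIGMA i:UNIV. {1..q i}"
  have inj: "inj_on (\<lambda>(i, j). ix i j) ?S"
    using assms(1) by (simp add: block_indexing_def bij_betw_def)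
  have mem: "(i, j) \<in> ?S"
    using assms by simp
  have eq: "(a i' j' *\<^sub>R axis (ix i' j') (1::real)) $ ix i j = (if (i', j') = (i, j) then a i j else 0)"
    if "(i', j') \<in> ?S" for i' j'
    using inj_onD[OF inj _ that mem] by (auto simp: axis_def)
  have "stack q ix a $ ix i j
      = (\<Sum>i'\<in>UNIV. \<Sum>j'=1..q i'. (a i' j' *\<^sub>R axis (ix i' j') (1::real)) $ ix i j)"
    unfolding stack_def sum_component ..
  also have "\<dots> = (\<Sum>(i', j')\<in>?S. (a i' j' *\<^sub>R axis (ix i' j') (1::real)) $ ix i j)"
    by (rule sum.Sigma) simp_all
  also have "\<dots> = (\<Sum>x\<in>?S. if x = (i, j) then a i j else 0)"
  proof (rule sum.cong[OF refl])
    fix x assume "x \<in> ?S"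
    then show "(case x of (i', j') \<Rightarrow> (a i' j' *\<^sub>R axis (ix i' j') (1::real)) $ ix i j)
        = (if x = (i, j) then a i j else 0)"
      using eq[of "fst x" "snd x"] by (simp only: split_beta prod.collapse)
  qed
  also have "\<dots> = a i j"
    using mem by (subst sum.delta) auto
  finally show ?thesis .
qed

definition output_map :: "('m::finite \<Rightarrow> nat \<Rightarrow> 'k::finite) \<Rightarrow> real ^ 'k \<Rightarrow> real ^ 'm" where
  "output_map ix \<xi> = (\<chi> i. \<xi> $ ix i 1)"

definition xi_rhs ::
  "('m::{finite,linorder} \<Rightarrow> nat) \<Rightarrow> ('m \<Rightarrow> nat \<Rightarrow> 'k::finite)
    \<Rightarrow> ('m \<Rightarrow> nat \<Rightarrow> 'm \<Rightarrow> 'z \<Rightarrow> real ^ 'k \<Rightarrow> real)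
    \<Rightarrow> ('m \<Rightarrow> nat \<Rightarrow> 'z \<Rightarrow> real ^ 'k \<Rightarrow> real \<Rightarrow> real)
    \<Rightarrow> ('m \<Rightarrow> real) \<Rightarrow> 'z \<Rightarrow> real ^ 'k \<Rightarrow> real \<Rightarrow> 'm \<Rightarrow> nat \<Rightarrow> real" where
  "xi_rhs q ix \<delta> p v z \<xi> w i j =
     (if j < q i then \<xi> $ ix i (j + 1) + (\<Sum>l\<in>{..<i}. \<delta> i j l z \<xi> * v l) else v i) + p i j z \<xi> w"

definition closed_loop ::
  "('m::{finite,linorder} \<Rightarrow> nat) \<Rightarrow> ('m \<Rightarrow> nat \<Rightarrow> 'k::finite)
    \<Rightarrow> ('z \<Rightarrow> real ^ 'm::{finite,linorder} \<Rightarrow> 'z) \<Rightarrow> ('z::euclidean_space \<Rightarrow> real \<Rightarrow> 'z)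
    \<Rightarrow> ('m \<Rightarrow> nat \<Rightarrow> 'm \<Rightarrow> 'z \<Rightarrow> real ^ 'k \<Rightarrow> real)
    \<Rightarrow> ('m \<Rightarrow> nat \<Rightarrow> 'z \<Rightarrow> real ^ 'k \<Rightarrow> real \<Rightarrow> real)
    \<Rightarrow> ('m \<Rightarrow> 'z \<Rightarrow> real ^ 'k \<Rightarrow> real)
    \<Rightarrow> 'z \<times> (real ^ 'k) \<Rightarrow> real \<Rightarrow> 'z \<times> (real ^ 'k)" where
  "closed_loop q ix f\<^sub>0 p\<^sub>0 \<delta> p v = (\<lambda>(z, \<xi>) w.
     (f\<^sub>0 z (output_map ix \<xi>) + p\<^sub>0 z w, stack q ix (xi_rhs q ix \<delta> p (\<lambda>i. v i z \<xi>) z \<xi> w)))"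

text \<open>
  \<open>g\<close> depends only on \<open>z\<close> and on the \<open>\<xi>\<^sub>a\<^sub>,\<^sub>b\<close> with \<open>b = 1\<close>, or \<open>b \<le> j - 1\<close>, or \<open>b = j\<close> and \<open>a \<le> i\<close>.
\<close>

definition depends_only_up_to ::
  "('m::{finite,linorder} \<Rightarrow> nat) \<Rightarrow> ('m \<Rightarrow> nat \<Rightarrow> 'k::finite) \<Rightarrow> 'm \<Rightarrow> nat
    \<Rightarrow> ('z \<Rightarrow> real ^ 'k \<Rightarrow> real) \<Rightarrow> bool" where
  "depends_only_up_to q ix i j g \<longleftrightarrow>
     (\<forall>z \<xi> \<xi>'.
        (\<forall>a b. 1 \<le> b \<and> b \<le> q a \<and> (b = 1 \<or> b < j \<or> (b = j \<and> a \<le> i)) \<longrightarrow> \<xi> $ ix a b = \<xi>' $ ix a b)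
        \<longrightarrow> g z \<xi> = g z \<xi>')"

end

theory Submission
  imports Defs
begin

text \<open>
  Backstepping over the levels \<open>j = 1, 2, \<dots>\<close>, all channels at once: the virtual control for
  \<open>\<xi>\<^sub>i\<^sub>,\<^sub>j\<^sub>+\<^sub>1\<close> (and \<open>v\<^sub>i\<close> if \<open>j = q i\<close>) is a smooth function of \<open>z\<close> and the levels up to \<open>j\<close>. A control \<open>v\<^sub>l\<close>
  enters channel \<open>i\<close> only at levels \<open>j \<ge> q l\<close>, where it is already known, or is designed at the same
  level with \<open>l < i\<close>. With \<open>e\<^sub>k\<close> the deviation of \<open>\<xi>\<^sub>k\<close> from its virtual control, the storage function is
  \<open>W = V(z) + (\<Sum>\<^sub>k e\<^sub>k\<^sup>2) / 2\<close>. The term produced in the \<open>z\<close>-equation by \<open>y \<noteq> \<phi>(z)\<close> is written by Hadamard's lemma as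
  \<open>\<Sum>\<^sub>i e\<^sub>i\<^sub>,\<^sub>1 g\<^sub>i(z, y)\<close> with smooth \<open>g\<^sub>i\<close>, so it can be cancelled exactly. Young's inequality
  dominates each disturbance term at the price of \<open>\<eta> w\<^sup>2\<close>, with \<open>\<eta> = \<epsilon>\<^sup>2 / CARD('k)\<close>.
\<close>

subsection \<open>Smooth maps\<close>

text \<open>Lets the closure properties below be proved by induction on \<open>k\<close> from the
  ordinary derivative rules, with no computation of \<open>frechet_derivative\<close>.\<close>

lemma times_cont_diff_SucI:
  assumes "\<And>x. (f has_derivative f' x) (at x)" and "\<And>u. times_cont_diff k (\<lambda>x. f' x u)"
  shows "times_cont_diff (Suc k) f"
proof -
  have "frechet_derivative f (at x) = f' x" for x
    using frechet_derivative_at[OF assms(1)] by simp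
  moreover have "f differentiable_on UNIV"
    using assms(1) by (auto simp: differentiable_on_def differentiable_def)
  ultimately show ?thesis using assms(2) by simp
qed

lemma times_cont_diff_has_derivative:
  assumes "times_cont_diff (Suc k) f"
  shows "(f has_derivative frechet_derivative f (at x)) (at x)"
  using assms by (simp add: differentiable_on_def flip: frechet_derivative_works)

lemma times_cont_diff_derivative:
  assumes "times_cont_diff (Suc k) f"
  shows "times_cont_diff k (\<lambda>x. frechet_derivative f (at x) u)"
  using assms by simp

lemma times_cont_diff_Suc_imp: "times_cont_diff (Suc k) f \<Longrightarrow> times_cont_diff k f"
proof (induction k arbitrary: f)
  case 0
  then show ?case by (simp add: differentiable_imp_continuous_on)
next
  case (Suc k)
  show ?case
    by (rule times_cont_diff_SucI[OF times_cont_diff_has_derivative[OF Suc.prems]])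
      (rule Suc.IH[OF times_cont_diff_derivative[OF Suc.prems]])
qed

lemma times_cont_diff_const: "times_cont_diff k (\<lambda>x. c)"
proof (induction k arbitrary: c)
  case (Suc k)
  show ?case
    by (rule times_cont_diff_SucI[OF has_derivative_const Suc.IH])
qed simp

lemma times_cont_diff_linear_compose:
  assumes "bounded_linear h"
  shows "times_cont_diff k f \<Longrightarrow> times_cont_diff k (\<lambda>x. h (f x))"
proof (induction k arbitrary: f)
  case 0
  then show ?case
    using bounded_linear.continuous_on[OF assms] by simp
next
  case (Suc k)
  show ?case
    by (rule times_cont_diff_SucI[OF bounded_linear.has_derivative[OF assms
            times_cont_diff_has_derivative[OF Suc.prems]]])
      (rule Suc.IH[OF times_cont_diff_derivative[OF Suc.prems]])
qed

lemma times_cont_diff_ident: "times_cont_diff k (\<lambda>x. x)"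
proof (cases k)
  case (Suc n)
  show ?thesis unfolding Suc
    by (rule times_cont_diff_SucI[OF has_derivative_ident times_cont_diff_const])
qed simp

lemma times_cont_diff_add:
  "times_cont_diff k f \<Longrightarrow> times_cont_diff k g \<Longrightarrow> times_cont_diff k (\<lambda>x. f x + g x)"
proof (induction k arbitrary: f g)
  case 0
  then show ?case by (simp add: continuous_on_add)
next
  case (Suc k)
  show ?case
    by (rule times_cont_diff_SucI[OF has_derivative_add[OF
            times_cont_diff_has_derivative[OF Suc.prems(1)]
            times_cont_diff_has_derivative[OF Suc.prems(2)]]])
      (rule Suc.IH[OF Suc.prems[THEN times_cont_diff_derivative]])
qed

lemma times_cont_diff_sum:
  "(\<And>i. i \<in> I \<Longrightarrow> times_cont_diff k (f i)) \<Longrightarrow> times_cont_diff k (\<lambda>x. \<Sum>i\<in>I. f i x)"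
  by (induction I rule: infinite_finite_induct)
    (simp_all add: times_cont_diff_const times_cont_diff_add)

lemma times_cont_diff_Pair:
  "times_cont_diff k f \<Longrightarrow> times_cont_diff k g \<Longrightarrow> times_cont_diff k (\<lambda>x. (f x, g x))"
proof (induction k arbitrary: f g)
  case 0
  then show ?case by (simp add: continuous_on_Pair)
next
  case (Suc k)
  show ?case
    by (rule times_cont_diff_SucI[OF has_derivative_Pair[OF
            times_cont_diff_has_derivative[OF Suc.prems(1)]
            times_cont_diff_has_derivative[OF Suc.prems(2)]]])
      (rule Suc.IH[OF Suc.prems[THEN times_cont_diff_derivative]])
qed

lemma times_cont_diff_bilinear:
  fixes f :: "'a::euclidean_space \<Rightarrow> 'b::euclidean_space"
    and g :: "'a \<Rightarrow> 'c::euclidean_space"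
    and prod :: "'b \<Rightarrow> 'c \<Rightarrow> 'd::euclidean_space"
  assumes "bounded_bilinear prod"
  shows "times_cont_diff k f \<Longrightarrow> times_cont_diff k g \<Longrightarrow> times_cont_diff k (\<lambda>x. prod (f x) (g x))"
proof (induction k arbitrary: f g)
  case 0
  then show ?case using bounded_bilinear.continuous_on[OF assms] by simp
next
  case (Suc k)
  show ?case
  proof (rule times_cont_diff_SucI[OF bounded_bilinear.FDERIV[OF assms
            times_cont_diff_has_derivative[OF Suc.prems(1)]
            times_cont_diff_has_derivative[OF Suc.prems(2)]]])
    fix u
    \<comment> \<open>The product rule returns two products of the same shape, so the induction
      hypothesis applies again, with the undifferentiated factor taken one class lower.\<close>
    show "times_cont_diff k (\<lambda>x. prod (f x) (frechet_derivative g (at x) u)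
        + prod (frechet_derivative f (at x) u) (g x))"
      using Suc.prems[THEN times_cont_diff_derivative] Suc.prems[THEN times_cont_diff_Suc_imp]
      by (intro times_cont_diff_add Suc.IH)
  qed
qed

text \<open>Turns a derivative in a direction that varies with the point into a finite sum of
  derivatives in fixed directions, the only ones \<open>times_cont_diff\<close> speaks
  about.\<close>

lemma linear_basis_expansion:
  assumes "linear L"
  shows "L v = (\<Sum>b\<in>Basis. (v \<bullet> b) *\<^sub>R L (b::'a::euclidean_space))"
proof -
  have "L v = L (\<Sum>b\<in>Basis. (v \<bullet> b) *\<^sub>R b)" by (simp add: euclidean_representation)
  also have "\<dots> = (\<Sum>b\<in>Basis. (v \<bullet> b) *\<^sub>R L b)"
    using assms by (simp add: linear_sum linear_scale)
  finally show ?thesis .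
qed

text \<open>Chain rule: expanded over the basis, the derivative is a sum of products of a component
  of the derivative of \<open>g\<close> with \<open>\<lambda>x. f' (g x) b\<close>, which is again a
  composition with the same \<open>g\<close>. Hence only \<open>f\<close> is generalised in the
  induction.\<close>

lemma times_cont_diff_compose:
  fixes f :: "'b::euclidean_space \<Rightarrow> 'c::euclidean_space" and g :: "'a::euclidean_space \<Rightarrow> 'b"
  shows "times_cont_diff k f \<Longrightarrow> times_cont_diff k g \<Longrightarrow> times_cont_diff k (\<lambda>x. f (g x))"
proof (induction k arbitrary: f)
  case 0
  then show ?case using continuous_on_compose2[of UNIV f UNIV g] by simp
next
  case (Suc k)
  let ?f' = "\<lambda>y. frechet_derivative f (at y)" and ?g' = "\<lambda>x. frechet_derivative g (at x)"
  have df: "(f has_derivative ?f' y) (at y)" and dg: "(g has_derivative ?g' x) (at x)" for x y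
    by (rule times_cont_diff_has_derivative[OF Suc.prems(1)]
        times_cont_diff_has_derivative[OF Suc.prems(2)])+
  have "((\<lambda>x. f (g x)) has_derivative (\<lambda>u. ?f' (g x) (?g' x u))) (at x)" for x
    using has_derivative_compose[OF dg df] .
  moreover have "times_cont_diff k (\<lambda>x. ?f' (g x) (?g' x u))" for u
  proof -
    have "(\<lambda>x. ?f' (g x) (?g' x u)) = (\<lambda>x. \<Sum>b\<in>Basis. (?g' x u \<bullet> b) *\<^sub>R ?f' (g x) b)"
      using linear_basis_expansion[OF has_derivative_linear[OF df]] by (intro ext)
    moreover have "times_cont_diff k \<dots>"
      using Suc.prems(2)[THEN times_cont_diff_Suc_imp] Suc.prems[THEN times_cont_diff_derivative]
      by (intro times_cont_diff_sum times_cont_diff_bilinear[OF bounded_bilinear_scaleR]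
          Suc.IH times_cont_diff_linear_compose[OF bounded_linear_inner_left])
    ultimately show ?thesis by simp
  qed
  ultimately show ?case by (rule times_cont_diff_SucI)
qed

text \<open>Differentiation under the integral sign gives an integral of the same form, whose
  integrand is the derivative of \<open>f\<close> in the direction \<open>(u, 0)\<close>.\<close>

lemma times_cont_diff_integral:
  fixes f :: "'a::euclidean_space \<times> real \<Rightarrow> 'b::euclidean_space"
  shows "times_cont_diff k f \<Longrightarrow> times_cont_diff k (\<lambda>x. integral {a..b} (\<lambda>t. f (x, t)))"
proof (induction k arbitrary: f)
  case 0
  then have "continuous_on (UNIV \<times> cbox a b) (\<lambda>(x, t). f (x, t))"
    by (auto intro: continuous_on_subset)
  from integral_continuous_on_param[OF this] show ?case by simp
next
  case (Suc k)
  let ?f' = "\<lambda>y. frechet_derivative f (at y)"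
  have df: "(f has_derivative ?f' y) (at y)" for y
    by (rule times_cont_diff_has_derivative[OF Suc.prems])
  have cont: "continuous_on UNIV (\<lambda>y. ?f' y u)" for u
  proof -
    have "times_cont_diff 0 f'" if "times_cont_diff k f'" for k and f' :: "'a \<times> real \<Rightarrow> 'b"
      using that by (induction k) (auto dest: times_cont_diff_Suc_imp simp del: times_cont_diff.simps)
    from this[OF times_cont_diff_derivative[OF Suc.prems]] show ?thesis by simp
  qed
  \<comment> \<open>The partial derivative in \<open>x\<close> is packaged as an operator, as
    \<open>leibniz_rule\<close> requires. Its continuity in operator norm follows from that of each
    directional derivative, by finite dimension.\<close>
  define fx where "fx x t = Blinfun (\<lambda>u. ?f' (x, t) (u, 0))" for x t
  have bl: "bounded_linear (\<lambda>u. ?f' (x, t) (u, 0))" for x t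
    by (rule bounded_linear_compose[OF has_derivative_bounded_linear[OF df]])
      (simp add: bounded_linear_Pair bounded_linear_ident bounded_linear_zero)
  have fx: "blinfun_apply (fx x t) = (\<lambda>u. ?f' (x, t) (u, 0))" for x t
    by (simp add: fx_def bounded_linear_Blinfun_apply bl)
  have d1: "((\<lambda>x. f (x, t)) has_derivative blinfun_apply (fx x t)) (at x within UNIV)" for x t
    unfolding fx by (rule has_derivative_compose[OF _ df]) (auto intro!: derivative_eq_intros)
  have cf: "continuous_on UNIV f"
    by (rule has_derivative_continuous_on) (use df in simp)
  have int: "(\<lambda>t. f (x, t)) integrable_on cbox a b" for x
    by (rule integrable_continuous) (intro continuous_on_compose2[OF cf] continuous_intros, auto)
  have cfx: "continuous_on (UNIV \<times> cbox a b) (\<lambda>(x, t). fx x t)"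
    by (rule continuous_on_blinfun_componentwise)
      (auto simp: fx split_beta intro!: continuous_on_subset[OF cont])
  have D: "((\<lambda>x. integral (cbox a b) (\<lambda>t. f (x, t))) has_derivative
      blinfun_apply (integral (cbox a b) (fx x))) (at x)" for x
    using leibniz_rule[OF d1 int cfx UNIV_I convex_UNIV] by simp
  have intfx: "(fx x) integrable_on cbox a b" for x
  proof (rule integrable_continuous)
    have "continuous_on (cbox a b) (\<lambda>t. (case (x, t) of (x, t) \<Rightarrow> fx x t))"
      by (rule continuous_on_compose2[OF cfx]) (auto intro!: continuous_intros)
    then show "continuous_on (cbox a b) (fx x)" by simp
  qed
  have ap: "blinfun_apply (integral (cbox a b) (fx x)) = (\<lambda>u. integral {a..b} (\<lambda>t. ?f' (x, t) (u, 0)))" for x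
    using blinfun_apply_integral[OF intfx, of x] by (simp add: fx fun_eq_iff)
  show ?case
  proof (rule times_cont_diff_SucI)
    show "((\<lambda>x. integral {a..b} (\<lambda>t. f (x, t))) has_derivative
      (\<lambda>u. integral {a..b} (\<lambda>t. ?f' (x, t) (u, 0)))) (at x)" for x
      using D[of x] unfolding ap by simp
    show "times_cont_diff k (\<lambda>x. integral {a..b} (\<lambda>t. ?f' (x, t) (u, 0)))" for u
      by (rule Suc.IH[OF times_cont_diff_derivative[OF Suc.prems]])
  qed
qed

section \<open>Closure rules for infinitely differentiable maps\<close>

lemma smooth_const: "smooth (\<lambda>x. c)"
  by (simp add: smooth_def times_cont_diff_const)

lemma smooth_ident: "smooth (\<lambda>x. x)"
  by (simp add: smooth_def times_cont_diff_ident)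

lemma smooth_linear_compose: "bounded_linear h \<Longrightarrow> smooth f \<Longrightarrow> smooth (\<lambda>x. h (f x))"
  by (simp add: smooth_def times_cont_diff_linear_compose)

lemma smooth_compose: "smooth f \<Longrightarrow> smooth g \<Longrightarrow> smooth (\<lambda>x. f (g x))"
  by (simp add: smooth_def times_cont_diff_compose)

lemma smooth_Pair: "smooth f \<Longrightarrow> smooth g \<Longrightarrow> smooth (\<lambda>x. (f x, g x))"
  by (simp add: smooth_def times_cont_diff_Pair)

lemma smooth_compose2:
  "smooth (\<lambda>(a, b). h a b) \<Longrightarrow> smooth f \<Longrightarrow> smooth g \<Longrightarrow> smooth (\<lambda>x. h (f x) (g x))"
  using smooth_compose[OF _ smooth_Pair, of "\<lambda>(a, b). h a b" f g] by simp

lemma smooth_add: "smooth f \<Longrightarrow> smooth g \<Longrightarrow> smooth (\<lambda>x. f x + g x)"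
  by (simp add: smooth_def times_cont_diff_add)

lemma smooth_sum: "(\<And>i. i \<in> I \<Longrightarrow> smooth (f i)) \<Longrightarrow> smooth (\<lambda>x. \<Sum>i\<in>I. f i x)"
  by (simp add: smooth_def times_cont_diff_sum)

lemma smooth_bilinear:
  "bounded_bilinear h \<Longrightarrow> smooth f \<Longrightarrow> smooth g \<Longrightarrow> smooth (\<lambda>x. h (f x) (g x))"
  by (simp add: smooth_def times_cont_diff_bilinear)

lemmas smooth_scaleR = smooth_bilinear[OF bounded_bilinear_scaleR]
lemmas smooth_mult = smooth_bilinear[OF bounded_bilinear_mult]
lemmas smooth_fst = smooth_linear_compose[OF bounded_linear_fst]
lemmas smooth_snd = smooth_linear_compose[OF bounded_linear_snd]
lemmas smooth_uminus = smooth_linear_compose[OF bounded_linear_minus[OF bounded_linear_ident]]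
lemmas smooth_inner_left = smooth_linear_compose[OF bounded_linear_inner_left]
lemmas smooth_vec_nth = smooth_linear_compose[OF bounded_linear_vec_nth]

lemma smooth_diff: "smooth f \<Longrightarrow> smooth g \<Longrightarrow> smooth (\<lambda>x. f x - g x)"
  using smooth_add[OF _ smooth_uminus, of f g] by simp

lemma smooth_power: "smooth f \<Longrightarrow> smooth (\<lambda>x. f x ^ n :: real)"
proof (induction n)
  case 0
  then show ?case by (simp add: smooth_const)
next
  case (Suc n)
  show ?case unfolding power_Suc by (rule smooth_mult[OF Suc.prems Suc.IH[OF Suc.prems]])
qed

lemma smooth_vec_lambda:
  fixes f :: "'i::finite \<Rightarrow> 'a::euclidean_space \<Rightarrow> real"
  assumes "\<And>i. smooth (f i)"
  shows "smooth (\<lambda>x. \<chi> i. f i x)"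
proof -
  have "(\<lambda>x. \<chi> i. f i x) = (\<lambda>x. \<Sum>i\<in>UNIV. f i x *\<^sub>R axis i 1)"
    by (auto simp: vec_eq_iff axis_def if_distrib cong: if_cong)
  then show ?thesis
    using assms by (simp add: smooth_sum smooth_scaleR smooth_const)
qed

lemma smooth_imp_continuous_on: "smooth f \<Longrightarrow> continuous_on S f"
  using continuous_on_subset[of UNIV f S] times_cont_diff.simps(1)[of f] by (simp add: smooth_def)

lemma smooth_has_derivative:
  "smooth f \<Longrightarrow> (f has_derivative frechet_derivative f (at x)) (at x)"
  unfolding smooth_def using times_cont_diff_has_derivative by blast

lemma smooth_linear_frechet_derivative: "smooth f \<Longrightarrow> linear (frechet_derivative f (at x))"
  by (rule has_derivative_linear[OF smooth_has_derivative])

lemma smooth_frechet_derivative: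
  assumes "smooth f" "smooth g" "smooth h"
  shows "smooth (\<lambda>x. frechet_derivative f (at (g x)) (h x))"
proof -
  have "smooth (\<lambda>y. frechet_derivative f (at y) u)" for u
    using assms(1) by (auto simp: smooth_def intro: times_cont_diff_derivative)
  from smooth_compose[OF this assms(2)]
  have "smooth (\<lambda>x. \<Sum>b\<in>Basis. (h x \<bullet> b) *\<^sub>R frechet_derivative f (at (g x)) b)"
    by (intro smooth_sum smooth_scaleR smooth_inner_left assms(3))
  moreover have "frechet_derivative f (at (g x)) (h x)
      = (\<Sum>b\<in>Basis. (h x \<bullet> b) *\<^sub>R frechet_derivative f (at (g x)) b)" for x
    by (rule linear_basis_expansion[OF smooth_linear_frechet_derivative[OF assms(1)]])
  ultimately show ?thesis
    by (simp only:)
qed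

lemma smooth_integral:
  "smooth (f :: 'a::euclidean_space \<times> real \<Rightarrow> 'b::euclidean_space) \<Longrightarrow>
    smooth (\<lambda>x. integral {a..b} (\<lambda>t. f (x, t)))"
  by (simp add: smooth_def times_cont_diff_integral)

lemma smooth_if: "(c \<Longrightarrow> smooth f) \<Longrightarrow> (\<not> c \<Longrightarrow> smooth g) \<Longrightarrow> smooth (\<lambda>x. if c then f x else g x)"
  by (cases c) simp_all

lemmas smooth_intros = smooth_const smooth_ident smooth_Pair smooth_add smooth_diff smooth_uminus
  smooth_sum smooth_mult smooth_scaleR smooth_fst smooth_snd smooth_inner_left smooth_vec_nth
  smooth_power smooth_vec_lambda smooth_if

text \<open>Integrates the derivative of \<open>H\<close> along the segment from \<open>x\<close> to
  \<open>y\<close>. The coefficients are smooth in both end points, and their values on the diagonal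
  are needed later to make the feedback vanish at the origin.\<close>

lemma smooth_Hadamard:
  fixes H :: "'a::euclidean_space \<Rightarrow> real"
  assumes "smooth H"
  obtains G where "\<And>b. smooth (G b)"
    and "\<And>x y. H y - H x = (\<Sum>b\<in>Basis. ((y - x) \<bullet> b) * G b (x, y))"
    and "\<And>b x. G b (x, x) = frechet_derivative H (at x) b"
proof
  let ?H' = "\<lambda>y. frechet_derivative H (at y)"
  \<comment> \<open>\<open>s ((x, y), t)\<close> is the point \<open>x + t (y - x)\<close> of the
    segment.\<close>
  define s where "s q = fst (fst q) + snd q *\<^sub>R (snd (fst q) - fst (fst q))"
    for q :: "('a \<times> 'a) \<times> real"
  define G where "G b p = integral {0..1} (\<lambda>t. ?H' (s (p, t)) b)" for b p
  have sm: "smooth (\<lambda>q. ?H' (s q) b)" for b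
    unfolding s_def by (intro smooth_frechet_derivative assms smooth_intros)
  then show "smooth (G b)" for b
    unfolding G_def by (rule smooth_integral)
  show "G b (x, x) = ?H' x b" for b x
    by (simp add: G_def s_def)
  show "H y - H x = (\<Sum>b\<in>Basis. ((y - x) \<bullet> b) * G b (x, y))" for x y
  proof -
    have "((\<lambda>t. H (s ((x, y), t))) has_vector_derivative ?H' (s ((x, y), t)) (y - x)) (at t within {0..1})" for t
    proof -
      have "((\<lambda>t. s ((x, y), t)) has_derivative (\<lambda>h. h *\<^sub>R (y - x))) (at t within {0..1})"
        unfolding s_def by (auto intro!: derivative_eq_intros)
      from has_derivative_compose[OF this smooth_has_derivative[OF assms]] show ?thesis
        by (simp add: has_vector_derivative_def linear_scale[OF smooth_linear_frechet_derivative[OF assms]])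
    qed
    then have "((\<lambda>t. ?H' (s ((x, y), t)) (y - x)) has_integral H (s ((x, y), 1)) - H (s ((x, y), 0))) {0..1}"
      by (intro fundamental_theorem_of_calculus) auto
    then have "((\<lambda>t. ?H' (s ((x, y), t)) (y - x)) has_integral H y - H x) {0..1}"
      by (simp add: s_def)
    moreover have "((\<lambda>t. ?H' (s ((x, y), t)) b) has_integral G b (x, y)) {0..1}" for b
      unfolding G_def
      by (intro integrable_integral integrable_continuous_real smooth_imp_continuous_on)
        (intro smooth_compose[OF sm] smooth_intros)
    then have "((\<lambda>t. \<Sum>b\<in>Basis. ((y - x) \<bullet> b) * ?H' (s ((x, y), t)) b) has_integral
        (\<Sum>b\<in>Basis. ((y - x) \<bullet> b) * G b (x, y))) {0..1}"
      by (intro has_integral_sum has_integral_mult_right) auto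
    moreover have "(\<Sum>b\<in>Basis. ((y - x) \<bullet> b) * ?H' (s ((x, y), t)) b) = ?H' (s ((x, y), t)) (y - x)" for t
      using linear_basis_expansion[OF smooth_linear_frechet_derivative[OF assms], of "s ((x, y), t)" "y - x"]
      by simp
    ultimately show ?thesis
      by (auto intro: has_integral_unique)
  qed
qed

subsection \<open>Comparison functions\<close>

text \<open>In terms of sublevel sets, properness can be checked by bounding \<open>z\<close> and
  the errors separately.\<close>

lemma radially_unbounded_iff_bounded_sublevel:
  "radially_unbounded Q \<longleftrightarrow> (\<forall>C. bounded {x. Q x \<le> C})"
proof -
  have "radially_unbounded Q \<longleftrightarrow> (\<forall>C. \<exists>B. \<forall>x. B \<le> norm x \<longrightarrow> C < Q x)"
    unfolding radially_unbounded_def filterlim_at_top_dense eventually_at_infinity by simp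
  also have "\<dots> \<longleftrightarrow> (\<forall>C. bounded {x. Q x \<le> C})"
  proof (intro iffI allI)
    fix C assume "\<forall>C. \<exists>B. \<forall>x. B \<le> norm x \<longrightarrow> C < Q x"
    then obtain B where "\<And>x. B \<le> norm x \<Longrightarrow> C < Q x" by blast
    then have "norm x \<le> B" if "Q x \<le> C" for x
      using that by (meson linorder_not_le less_imp_le)
    then show "bounded {x. Q x \<le> C}" by (auto simp: bounded_iff)
  next
    fix C assume "\<forall>C. bounded {x. Q x \<le> C}"
    then obtain B where "\<And>x. Q x \<le> C \<Longrightarrow> norm x \<le> B" by (auto simp: bounded_iff)
    then have "C < Q x" if "B + 1 \<le> norm x" for x
      using that by (meson not_less order_trans add_le_same_cancel1 not_one_le_zero)
    then show "\<exists>B. \<forall>x. B \<le> norm x \<longrightarrow> C < Q x" by blast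
  qed
  finally show ?thesis .
qed

text \<open>Converts decay by a positive definite proper function of the whole state into decay by a
  class K-infinity function of its norm, as strict dissipativity demands.\<close>

lemma class_K_inf_minorant:
  fixes Q :: "'a::euclidean_space \<Rightarrow> real"
  assumes cont: "continuous_on UNIV Q" and pd: "positive_definite Q" and ru: "radially_unbounded Q"
  obtains \<alpha> where "class_K_inf \<alpha>" "\<And>x. \<alpha> (norm x) \<le> Q x"
proof -
  \<comment> \<open>An infimal convolution, hence 1-Lipschitz, unlike the infimum of \<open>Q\<close> over the exterior of a ball.\<close>
  define m where "m r = (INF x. Q x + max 0 (r - norm x))" for r
  have Q0: "Q x \<ge> 0" for x
    using pd by (cases "x = 0") (auto simp: positive_definite_def less_imp_le)
  have lower: "m r \<le> Q x + max 0 (r - norm x)" for r x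
    unfolding m_def by (rule cINF_lower) (auto intro!: bdd_belowI[of _ 0] add_nonneg_nonneg Q0)
  have greatest: "c \<le> m r" if "\<And>x. c \<le> Q x + max 0 (r - norm x)" for c r
    unfolding m_def by (rule cINF_greatest) (use that in auto)
  have m_nonneg: "0 \<le> m r" for r
    by (rule greatest) (simp add: Q0)
  have m_mono: "m r \<le> m s" if "r \<le> s" for r s
  proof (rule greatest)
    show "m r \<le> Q x + max 0 (s - norm x)" for x
      using lower[of r x] that by linarith
  qed
  have m_lip: "m s - \<bar>s - r\<bar> \<le> m r" for r s
  proof (rule greatest)
    show "m s - \<bar>s - r\<bar> \<le> Q x + max 0 (r - norm x)" for x
      using lower[of s x] by linarith
  qed
  have m_cont: "continuous_on S m" for S
  proof (rule continuous_on_subset[OF _ subset_UNIV], unfold continuous_on_iff, intro ballI allI impI)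
    fix r e :: real assume "0 < e"
    have "dist (m s) (m r) \<le> dist s r" for s
      using m_lip[of s r] m_lip[of r s] by (auto simp: dist_real_def)
    then show "\<exists>d>0. \<forall>s\<in>UNIV. dist s r < d \<longrightarrow> dist (m s) (m r) < e"
      using \<open>0 < e\<close> by (intro exI[of _ e]) (auto intro: le_less_trans)
  qed
  have ru': "\<exists>B. \<forall>x. B \<le> norm x \<longrightarrow> C < Q x" for C
    using ru unfolding radially_unbounded_def filterlim_at_top_dense eventually_at_infinity by simp
  have m_pos: "0 < m r" if "0 < r" for r
  proof -
    obtain B where B: "\<And>x. B \<le> norm x \<Longrightarrow> 1 < Q x" using ru'[of 1] by blast
    define K where "K = cball (0::'a) B - ball 0 (r / 2)"
    have "\<exists>c>0. \<forall>x\<in>K. c \<le> Q x"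
    proof (cases "K = {}")
      case False
      have "compact K" by (simp add: K_def compact_diff)
      then obtain y where y: "y \<in> K" "\<And>x. x \<in> K \<Longrightarrow> Q y \<le> Q x"
        using continuous_attains_inf[OF _ False continuous_on_subset[OF cont subset_UNIV]] by blast
      have "y \<noteq> 0" using y(1) that by (auto simp: K_def)
      then show ?thesis using y(2) pd by (auto simp: positive_definite_def)
    qed (auto intro: exI[of _ 1])
    then obtain c where c: "c > 0" "\<And>x. x \<in> K \<Longrightarrow> c \<le> Q x" by blast
    have "min (min c 1) (r / 2) \<le> m r"
    proof (rule greatest)
      fix x
      \<comment> \<open>Near the origin the penalty exceeds \<open>r / 2\<close>, on the compact
        shell \<open>K\<close> the function \<open>Q\<close> is at least \<open>c\<close>, and far
        away it exceeds 1.\<close>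
      consider "norm x < r / 2" | "x \<in> K" | "B \<le> norm x" by (fastforce simp: K_def)
      then show "min (min c 1) (r / 2) \<le> Q x + max 0 (r - norm x)"
        by cases (use Q0[of x] c(2)[of x] B[of x] in linarith)+
    qed
    then show ?thesis using c(1) that by linarith
  qed
  \<comment> \<open>The factor increases strictly from 0 and stays below 1: it makes the monotone
    \<open>m\<close> strictly increasing without raising it. For \<open>r \<ge> 1\<close> it is at
    least 1/2, so unboundedness survives.\<close>
  define \<alpha> where "\<alpha> r = r / (1 + r) * m r" for r
  have "continuous_on {0..} \<alpha>"
    unfolding \<alpha>_def by (intro continuous_intros m_cont) auto
  moreover have "strict_mono_on {0..} \<alpha>"
  proof (rule strict_mono_onI)
    fix r s :: real assume rs: "r \<in> {0..}" "s \<in> {0..}" "r < s"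
    have "\<alpha> r \<le> r / (1 + r) * m s"
      unfolding \<alpha>_def using rs m_mono[of r s] by (intro mult_left_mono) auto
    also have "\<dots> < s / (1 + s) * m s"
      using rs m_pos[of s] by (intro mult_strict_right_mono) (auto simp: divide_simps algebra_simps)
    finally show "\<alpha> r < \<alpha> s" unfolding \<alpha>_def .
  qed
  moreover have "\<not> bdd_above (\<alpha> ` {0..})"
  proof
    assume "bdd_above (\<alpha> ` {0..})"
    then obtain M where M: "\<And>r. 0 \<le> r \<Longrightarrow> \<alpha> r \<le> M" by (auto simp: bdd_above_def)
    \<comment> \<open>Chosen so that half of \<open>C\<close>, all that the factor 1/2 leaves, still
      exceeds \<open>M\<close>. With \<open>r\<close> as below, points inside radius
      \<open>B\<close> pay a penalty of at least \<open>C\<close>, and the others have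
      \<open>Q\<close> above \<open>C\<close>.\<close>
    define C where "C = 2 * \<bar>M\<bar> + 1"
    obtain B where B: "\<And>x. B \<le> norm x \<Longrightarrow> C < Q x" using ru'[of C] by blast
    define r where "r = \<bar>B\<bar> + C"
    have "C \<le> m r"
    proof (rule greatest)
      show "C \<le> Q x + max 0 (r - norm x)" for x
        using Q0[of x] B[of x] by (cases "B \<le> norm x") (auto simp: r_def)
    qed
    moreover have "1 / 2 \<le> r / (1 + r)" "0 \<le> r"
      by (auto simp: r_def C_def divide_simps)
    ultimately have "1 / 2 * C \<le> \<alpha> r"
      unfolding \<alpha>_def by (intro mult_mono) (auto simp: C_def)
    with M[OF \<open>0 \<le> r\<close>] show False by (simp add: C_def)
  qed
  ultimately have "class_K_inf \<alpha>" by (simp add: class_K_inf_def \<alpha>_def)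
  moreover have "\<alpha> (norm x) \<le> Q x" for x
  proof -
    have "\<alpha> (norm x) \<le> 1 * m (norm x)"
      unfolding \<alpha>_def by (intro mult_right_mono m_nonneg) (use norm_ge_zero[of x] in \<open>auto simp: divide_simps simp del: norm_ge_zero\<close>)
    with lower[of "norm x" x] show ?thesis by simp
  qed
  ultimately show ?thesis using that by blast
qed

subsection \<open>Backstepping\<close>

text \<open>The storage function \<open>V\<close> enters the design only through \<open>g\<close>,
  later instantiated with Hadamard coefficients of the derivative of \<open>V\<close> along
  \<open>f\<^sub>0\<close>. The number \<open>\<eta>\<close> is the price of one use of Young's
  inequality.\<close>

locale backstepping =
  fixes q :: "'m::{finite,linorder} \<Rightarrow> nat"
    and ix :: "'m \<Rightarrow> nat \<Rightarrow> 'k::finite"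
    and f\<^sub>0 :: "'z::euclidean_space \<Rightarrow> real ^ 'm::{finite,linorder} \<Rightarrow> 'z"
    and p\<^sub>0 :: "'z \<Rightarrow> real \<Rightarrow> 'z"
    and \<delta> :: "'m \<Rightarrow> nat \<Rightarrow> 'm \<Rightarrow> 'z \<Rightarrow> real ^ 'k \<Rightarrow> real"
    and p :: "'m \<Rightarrow> nat \<Rightarrow> 'z \<Rightarrow> real ^ 'k \<Rightarrow> real \<Rightarrow> real"
    and R\<^sub>0 :: "'z \<Rightarrow> real"
    and R :: "'m \<Rightarrow> nat \<Rightarrow> 'z \<Rightarrow> real ^ 'k \<Rightarrow> real"
    and \<phi> :: "'m \<Rightarrow> 'z \<Rightarrow> real"
    and g :: "'m \<Rightarrow> 'z \<Rightarrow> real ^ 'm::{finite,linorder} \<Rightarrow> real"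
    and \<eta> :: real
  assumes q_pos: "\<And>i. 1 \<le> q i"
    and ix: "block_indexing q ix"
    and smooth_f0: "smooth (\<lambda>(z, u). f\<^sub>0 z u)"
    and f0_zero: "f\<^sub>0 0 0 = 0"
    and smooth_delta: "\<And>i j l. \<lbrakk>1 \<le> j; j < q i; l < i\<rbrakk> \<Longrightarrow> smooth (\<lambda>(z, \<xi>). \<delta> i j l z \<xi>)"
    and delta_zero: "\<And>i j l z \<xi>. \<lbrakk>1 \<le> j; j < q i; l < i; j < q l\<rbrakk> \<Longrightarrow> \<delta> i j l z \<xi> = 0"
    and smooth_R0: "smooth R\<^sub>0"
    and smooth_R: "\<And>i j. \<lbrakk>1 \<le> j; j \<le> q i\<rbrakk> \<Longrightarrow> smooth (\<lambda>(z, \<xi>). R i j z \<xi>)"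
    and p0_bound: "\<And>z w. norm (p\<^sub>0 z w) \<le> R\<^sub>0 z * norm w"
    and p_bound: "\<And>i j z \<xi> w. \<lbrakk>1 \<le> j; j \<le> q i\<rbrakk> \<Longrightarrow> \<bar>p i j z \<xi> w\<bar> \<le> R i j z \<xi> * norm w"
    and smooth_phi: "\<And>i. smooth (\<phi> i)"
    and phi_zero: "\<And>i. \<phi> i 0 = 0"
    and delta_dep: "\<And>i j l. \<lbrakk>1 \<le> j; j < q i; l < i\<rbrakk> \<Longrightarrow> depends_only_up_to q ix i j (\<delta> i j l)"
    and p_dep: "\<And>i j w. \<lbrakk>1 \<le> j; j \<le> q i\<rbrakk> \<Longrightarrow> depends_only_up_to q ix i j (\<lambda>z \<xi>. p i j z \<xi> w)"
    and smooth_g: "\<And>i. smooth (\<lambda>(z, u). g i z u)"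
    and g_zero: "\<And>i. g i 0 0 = 0"
    and eta_pos: "\<eta> > 0"
begin

section \<open>Channel and level of a coordinate\<close>

definition ch :: "'k \<Rightarrow> 'm" where
  "ch k = fst (inv_into (SIGMA i:UNIV. {1..q i}) (\<lambda>(i, j). ix i j) k)"

definition lev :: "'k \<Rightarrow> nat" where
  "lev k = snd (inv_into (SIGMA i:UNIV. {1..q i}) (\<lambda>(i, j). ix i j) k)"

lemma ix_ch_lev [simp]: "ix (ch k) (lev k) = k"
  and lev_ge_1: "1 \<le> lev k" and lev_le_q: "lev k \<le> q (ch k)"
proof -
  let ?S = "SIGMA i:UNIV. {1..q i}" and ?f = "\<lambda>(i, j). ix i j"
  have im: "k \<in> ?f ` ?S"
    using ix by (auto simp: block_indexing_def bij_betw_def)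
  show "ix (ch k) (lev k) = k"
    using f_inv_into_f[OF im] by (simp add: ch_def lev_def split_beta)
  have "inv_into ?S ?f k \<in> ?S"
    by (rule inv_into_into[OF im])
  then show "1 \<le> lev k" "lev k \<le> q (ch k)"
    by (auto simp: ch_def lev_def)
qed

lemma
  assumes "1 \<le> j" "j \<le> q i"
  shows ch_ix: "ch (ix i j) = i" and lev_ix: "lev (ix i j) = j"
proof -
  let ?S = "SIGMA i:UNIV. {1..q i}" and ?f = "\<lambda>(i, j). ix i j"
  have "inv_into ?S ?f (?f (i, j)) = (i, j)"
    using ix assms by (intro inv_into_f_f) (auto simp: block_indexing_def bij_betw_def)
  then show "ch (ix i j) = i" "lev (ix i j) = j"
    by (auto simp: ch_def lev_def)
qed

text \<open>\<open>prv\<close> is meaningful only if \<open>lev k \<noteq> 1\<close>, and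
  \<open>nxt\<close> only if \<open>lev k < q (ch k)\<close>; uses are guarded accordingly.\<close>

definition prv :: "'k \<Rightarrow> 'k" where "prv k = ix (ch k) (lev k - 1)"
definition nxt :: "'k \<Rightarrow> 'k" where "nxt k = ix (ch k) (lev k + 1)"
definition ini :: "'m \<Rightarrow> 'k" where "ini i = ix i 1"
definition lst :: "'m \<Rightarrow> 'k" where "lst i = ix i (q i)"

lemma prv [simp]:
  assumes "lev k \<noteq> 1" shows "ch (prv k) = ch k" "lev (prv k) = lev k - 1"
proof -
  have "1 \<le> lev k - 1" "lev k - 1 \<le> q (ch k)"
    using assms lev_ge_1[of k] lev_le_q[of k] by linarith+
  then show "ch (prv k) = ch k" "lev (prv k) = lev k - 1"
    by (simp_all add: prv_def ch_ix lev_ix)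
qed

lemma nxt [simp]:
  assumes "lev k < q (ch k)" shows "ch (nxt k) = ch k" "lev (nxt k) = lev k + 1"
  using assms by (simp_all add: nxt_def ch_ix lev_ix)

lemma lst [simp]: "ch (lst i) = i" "lev (lst i) = q i"
  using q_pos by (simp_all add: lst_def ch_ix lev_ix)

lemma ini [simp]: "ch (ini i) = i" "lev (ini i) = 1"
  using q_pos by (simp_all add: ini_def ch_ix lev_ix)

section \<open>Truncation of the state to its first levels\<close>

definition pr :: "nat \<Rightarrow> 'z \<times> (real ^ 'k) \<Rightarrow> 'z \<times> (real ^ 'k)" where
  "pr j x = (fst x, \<chi> k. if lev k \<le> j then snd x $ k else 0)"

lemma fst_pr [simp]: "fst (pr j x) = fst x"
  and snd_pr_nth: "snd (pr j x) $ k = (if lev k \<le> j then snd x $ k else 0)"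
  by (simp_all add: pr_def)

lemma pr_pr: "pr i (pr j x) = pr (min i j) x"
  by (auto simp: pr_def vec_eq_iff)

lemma bounded_linear_pr: "bounded_linear (pr j)"
  unfolding linear_conv_bounded_linear[symmetric]
  by (rule linearI) (auto simp: pr_def vec_eq_iff)

text \<open>A state and its truncation agree on all admissible coordinates; those of level 1 are
  kept because \<open>1 \<le> j'\<close>.\<close>

lemma depends_only_up_to_pr:
  assumes "depends_only_up_to q ix i j h" "1 \<le> j" "j \<le> j'"
  shows "h z (snd (pr j' x)) = h z (snd x)"
  using assms(1)[unfolded depends_only_up_to_def, THEN spec, THEN spec, THEN spec]
  by (rule mp) (use assms(2,3) in \<open>auto simp: snd_pr_nth lev_ix\<close>)

text \<open>Dependence on \<open>z\<close> and the levels up to \<open>j\<close>, expressed as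
  invariance under a linear projection so that derivatives inherit it by the chain rule.\<close>

definition dep :: "nat \<Rightarrow> ('z \<times> (real ^ 'k) \<Rightarrow> 'b) \<Rightarrow> bool" where
  "dep j h \<longleftrightarrow> (\<forall>x. h (pr j x) = h x)"

lemma dep_pr: "dep j h \<Longrightarrow> h (pr j x) = h x"
  unfolding dep_def by blast

lemma dep_mono: "dep i h \<Longrightarrow> i \<le> j \<Longrightarrow> dep j h"
  unfolding dep_def by (metis pr_pr min_absorb1)

text \<open>Differentiating \<open>h = h \<circ> pr j\<close> projects the base point and the
  direction simultaneously; idempotence of \<open>pr j\<close> then separates the two
  claims.\<close>

lemma dep_frechet_derivative:
  assumes "dep j h" "smooth h"
  shows "frechet_derivative h (at (pr j x)) v = frechet_derivative h (at x) v"
    and "frechet_derivative h (at x) (pr j v) = frechet_derivative h (at x) v"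
proof -
  have eq: "frechet_derivative h (at y) v = frechet_derivative h (at (pr j y)) (pr j v)" for y v
  proof -
    have "((\<lambda>x. h (pr j x)) has_derivative (\<lambda>v. frechet_derivative h (at (pr j y)) (pr j v))) (at y)"
      by (rule has_derivative_compose[OF bounded_linear_imp_has_derivative[OF bounded_linear_pr]
            smooth_has_derivative[OF assms(2)]])
    moreover have "(\<lambda>x. h (pr j x)) = h"
      using assms(1) by (auto simp: dep_def)
    ultimately show ?thesis
      using frechet_derivative_at by metis
  qed
  show "frechet_derivative h (at (pr j x)) v = frechet_derivative h (at x) v"
    using eq[of x v] eq[of "pr j x" v] by (simp add: pr_pr)
  show "frechet_derivative h (at x) (pr j v) = frechet_derivative h (at x) v"
    using eq[of x v] eq[of x "pr j v"] by (simp add: pr_pr)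
qed

definition out :: "'z \<times> (real ^ 'k) \<Rightarrow> real ^ 'm::{finite,linorder}" where
  "out x = output_map ix (snd x)"

lemma out_nth: "out x $ i = snd x $ ini i"
  by (simp add: ini_def out_def output_map_def)

lemma smooth_out: "smooth out"
proof -
  have "out = (\<lambda>x. \<chi> i. snd x $ ix i 1)"
    by (auto simp: out_def output_map_def)
  then show ?thesis by (auto intro!: smooth_intros)
qed

lemma out_pr [simp]: "1 \<le> j \<Longrightarrow> out (pr j x) = out x"
  by (simp add: vec_eq_iff out_nth snd_pr_nth del: One_nat_def)

text \<open>In the following operators \<open>U\<close> is the family of virtual controls: \<open>U (ix i j)\<close> is the value
  prescribed for \<open>\<xi>\<^sub>i\<^sub>,\<^sub>j\<^sub>+\<^sub>1\<close>, and for \<open>v\<^sub>i\<close> if \<open>j = q i\<close>.\<close>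

definition Phi :: "('k \<Rightarrow> 'z \<times> (real ^ 'k) \<Rightarrow> real) \<Rightarrow> 'k \<Rightarrow> 'z \<times> (real ^ 'k) \<Rightarrow> real" where
  "Phi U k = (if lev k = 1 then \<lambda>x. \<phi> (ch k) (fst x) else U (prv k))"

definition err :: "('k \<Rightarrow> 'z \<times> (real ^ 'k) \<Rightarrow> real) \<Rightarrow> 'k \<Rightarrow> 'z \<times> (real ^ 'k) \<Rightarrow> real" where
  "err U k x = snd x $ k - Phi U k x"

text \<open>Since \<open>U (lst l)\<close> is the control \<open>v\<^sub>l\<close>, the restriction
  \<open>q l \<le> lev k\<close> keeps only controls already designed; the omitted terms vanish by
  \<open>delta_zero\<close>. At the last level of a channel the index set is empty, matching the
  absence of coupling there.\<close>

definition coupling :: "('k \<Rightarrow> 'z \<times> (real ^ 'k) \<Rightarrow> real) \<Rightarrow> 'k \<Rightarrow> 'z \<times> (real ^ 'k) \<Rightarrow> real" where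
  "coupling U k x = (\<Sum>l | l < ch k \<and> lev k < q (ch k) \<and> q l \<le> lev k.
     \<delta> (ch k) (lev k) l (fst x) (snd x) * U (lst l) x)"

definition xi_drift :: "('k \<Rightarrow> 'z \<times> (real ^ 'k) \<Rightarrow> real) \<Rightarrow> 'k \<Rightarrow> 'z \<times> (real ^ 'k) \<Rightarrow> real" where
  "xi_drift U k x = (if lev k < q (ch k) then snd x $ nxt k + coupling U k x else U k x)"

text \<open>The undisturbed velocity, truncated to the levels on which \<open>Phi U k\<close> can
  depend when \<open>j = lev k\<close>.\<close>

definition drift_below ::
  "('k \<Rightarrow> 'z \<times> (real ^ 'k) \<Rightarrow> real) \<Rightarrow> nat \<Rightarrow> 'z \<times> (real ^ 'k) \<Rightarrow> 'z \<times> (real ^ 'k)" where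
  "drift_below U j x = (f\<^sub>0 (fst x) (out x), \<chi> k. if lev k < j then xi_drift U k x else 0)"

text \<open>\<open>R\<close> itself may depend on coordinates which \<open>p\<close> does not see.\<close>

definition gain :: "'k \<Rightarrow> 'z \<times> (real ^ 'k) \<Rightarrow> real" where
  "gain k x = R (ch k) (lev k) (fst x) (snd (pr (lev k) x))"

text \<open>\<open>1 + t\<^sup>2\<close> serves as a smooth bound for \<open>\<bar>t\<bar>\<close>.\<close>

definition err_gain :: "('k \<Rightarrow> 'z \<times> (real ^ 'k) \<Rightarrow> real) \<Rightarrow> 'k \<Rightarrow> 'z \<times> (real ^ 'k) \<Rightarrow> real" where
  "err_gain U k x = gain k x + (\<Sum>b\<in>Basis. 1 + (frechet_derivative (Phi U k) (at x) b)\<^sup>2)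
     * (R\<^sub>0 (fst x) + (\<Sum>k' | lev k' < lev k. gain k' x))"

text \<open>The indefinite terms to be cancelled. At level 1, \<open>g\<close> accounts for the
  error in the z-equation and \<open>2 * \<phi>\<close> for the mixed term in the squared norm of
  \<open>y = \<phi> + e\<close>; at higher levels it is the term that the preceding error equation
  leaves behind.\<close>

definition cross :: "('k \<Rightarrow> 'z \<times> (real ^ 'k) \<Rightarrow> real) \<Rightarrow> 'k \<Rightarrow> 'z \<times> (real ^ 'k) \<Rightarrow> real" where
  "cross U k x = (if lev k = 1 then g (ch k) (fst x) (out x) + 2 * \<phi> (ch k) (fst x) else err U (prv k) x)"

text \<open>Of the damping coefficient 2, one unit pays for the level 1 errors in the squared norm
  of \<open>y\<close> and one remains as decay. The term with \<open>4 * \<eta>\<close> is the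
  remainder of Young's inequality. The last two terms compensate the known motion of the virtual
  control and the coupling.\<close>

definition design :: "('k \<Rightarrow> 'z \<times> (real ^ 'k) \<Rightarrow> real) \<Rightarrow> 'k \<Rightarrow> 'z \<times> (real ^ 'k) \<Rightarrow> real" where
  "design U k x = - cross U k x - err U k x * (2 + (err_gain U k x)\<^sup>2 / (4 * \<eta>))
     + frechet_derivative (Phi U k) (at x) (drift_below U (lev k) x) - coupling U k x"

section \<open>Recursion over level and channel\<close>

definition before :: "('k \<times> 'k) set" where
  "before = measures [lev, \<lambda>k. card {..<ch k}]"

text \<open>The cardinality of an initial segment encodes the rank of a channel as a natural number,
  as \<open>measures\<close> requires; it is strictly monotone because the channel type is
  finite.\<close>

lemma before_iff: "(k', k) \<in> before \<longleftrightarrow> lev k' < lev k \<or> lev k' = lev k \<and> ch k' < ch k"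
proof -
  have "card {..<a} < card {..<b} \<longleftrightarrow> a < b" for a b :: 'm
  proof
    assume "a < b"
    then show "card {..<a} < card {..<b}" by (intro psubset_card_mono) auto
  next
    assume *: "card {..<a} < card {..<b}"
    have "card {..<b} \<le> card {..<a}" if "b \<le> a"
      using that by (intro card_mono) auto
    with * show "a < b" by (meson leD not_less)
  qed
  then show ?thesis by (auto simp: before_def)
qed

lemma wf_before: "wf before"
  by (simp add: before_def)

lemma prv_before: "lev k \<noteq> 1 \<Longrightarrow> (prv k, k) \<in> before"
  using lev_ge_1[of k] by (simp add: before_iff)

lemma lst_before: "l < ch k \<Longrightarrow> q l \<le> lev k \<Longrightarrow> (lst l, k) \<in> before"
  by (auto simp: before_iff)

lemma Phi_cong:
  assumes "\<And>k'. (k', k) \<in> before \<Longrightarrow> U k' = U' k'"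
  shows "Phi U k = Phi U' k"
  using assms[OF prv_before] by (auto simp: Phi_def)

lemma coupling_cong:
  assumes "\<And>k'. (k', k) \<in> before \<Longrightarrow> U k' = U' k'"
  shows "coupling U k = coupling U' k"
  unfolding coupling_def using assms[OF lst_before] by (intro ext sum.cong) auto

lemma trans_before: "(a, b) \<in> before \<Longrightarrow> (b, c) \<in> before \<Longrightarrow> (a, c) \<in> before"
  by (auto simp: before_iff)

text \<open>The design at \<open>k\<close> reads only controls that precede \<open>k\<close>, which
  makes the equation \<open>U k = design U k\<close> a legitimate recursion.\<close>

lemma design_cong:
  assumes *: "\<And>k'. (k', k) \<in> before \<Longrightarrow> U k' = U' k'"
  shows "design U k = design U' k"
proof -
  have "cross U k = cross U' k"
    using Phi_cong[of "prv k" U U'] * trans_before[OF _ prv_before]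
    by (auto simp: cross_def err_def fun_eq_iff)
  moreover have "xi_drift U k' = xi_drift U' k'" if "lev k' < lev k" for k'
    using that coupling_cong[of k' U U'] *[OF trans_before] *[of k']
    by (auto simp: xi_drift_def before_iff fun_eq_iff)
  then have "drift_below U (lev k) = drift_below U' (lev k)"
    by (auto simp: drift_below_def fun_eq_iff vec_eq_iff)
  moreover have "Phi U k = Phi U' k" "coupling U k = coupling U' k"
    by (intro Phi_cong coupling_cong *; assumption)+
  ultimately show ?thesis
    by (intro ext) (simp add: design_def err_gain_def err_def)
qed

definition U :: "'k \<Rightarrow> 'z \<times> (real ^ 'k) \<Rightarrow> real" where
  "U = (SOME U. \<forall>k. U k = design U k)"

text \<open>Well-founded choice for the deterministic relation \<open>r = design U k\<close>
  produces a solution; \<open>design_cong\<close> supplies the required locality.\<close>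

lemma U_eq: "U k = design U k"
proof -
  have "\<exists>U. \<forall>k. U k = design U k"
  proof (rule dependent_wf_choice[where P = "\<lambda>U k r. r = design U k", OF wf_before])
    fix U U' :: "'k \<Rightarrow> 'z \<times> (real ^ 'k) \<Rightarrow> real" and k r assume "\<And>k'. (k', k) \<in> before \<Longrightarrow> U k' = U' k'"
    then show "(r = design U k) = (r = design U' k)"
      using design_cong[of k U U'] by simp
  qed simp
  then show ?thesis
    unfolding U_def by (rule someI2_ex) blast
qed

section \<open>Smoothness of the virtual controls\<close>

lemma Phi_smooth:
  assumes "\<And>k'. (k', k) \<in> before \<Longrightarrow> smooth (U k')"
  shows "smooth (Phi U k)"
  using assms[OF prv_before] smooth_compose[OF smooth_phi smooth_fst[OF smooth_ident]]
  by (auto simp: Phi_def)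

lemma coupling_smooth:
  assumes "\<And>k'. (k', k) \<in> before \<Longrightarrow> smooth (U k')"
  shows "smooth (coupling U k)"
  unfolding coupling_def using lev_ge_1[of k]
  by (intro smooth_sum smooth_mult smooth_compose2[OF smooth_delta] smooth_intros assms lst_before) auto

lemma smooth_pr: "smooth (pr j)"
  by (rule smooth_linear_compose[OF bounded_linear_pr smooth_ident])

lemma smooth_gain: "smooth (gain k)"
  unfolding gain_def
  by (intro smooth_compose2[OF smooth_R] smooth_fst smooth_snd smooth_ident smooth_pr lev_ge_1 lev_le_q)

lemma smooth_design:
  assumes *: "\<And>k'. (k', k) \<in> before \<Longrightarrow> smooth (U k')"
  shows "smooth (design U k)"
proof -
  have sf: "smooth (\<lambda>x::'z \<times> (real ^ 'k). fst x)" and ss: "smooth (\<lambda>x::'z \<times> (real ^ 'k). snd x)"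
    by (intro smooth_fst smooth_snd smooth_ident)+
  have P: "smooth (Phi U k)"
    by (rule Phi_smooth[OF *])
  have e: "smooth (err U k')" if "smooth (Phi U k')" for k'
    unfolding err_def by (intro smooth_diff smooth_vec_nth ss that)
  have "smooth (cross U k)"
  proof (cases "lev k = 1")
    case True
    then show ?thesis
      unfolding cross_def
      by (simp, intro smooth_add smooth_mult smooth_const smooth_compose2[OF smooth_g] sf smooth_out
          smooth_compose[OF smooth_phi])
  next
    case False
    then have "smooth (Phi U (prv k))"
      by (intro Phi_smooth *) (rule trans_before[OF _ prv_before])
    with False show ?thesis
      unfolding cross_def by (simp add: e)
  qed
  moreover have "smooth (xi_drift U k')" if "lev k' < lev k" for k'
  proof -
    have "smooth (coupling U k')" "smooth (U k')"
      using that by (auto intro!: coupling_smooth * simp: before_iff)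
    then show ?thesis
      unfolding xi_drift_def by (intro smooth_if smooth_add smooth_vec_nth ss)
  qed
  then have "smooth (drift_below U (lev k))"
    unfolding drift_below_def
    by (intro smooth_Pair smooth_vec_lambda smooth_compose2[OF smooth_f0] sf smooth_out smooth_if smooth_const)
  moreover have "smooth (err_gain U k)"
    unfolding err_gain_def
    by (intro smooth_add smooth_mult smooth_sum smooth_power smooth_frechet_derivative P smooth_gain
        smooth_const smooth_ident smooth_compose[OF smooth_R0] sf)
  ultimately show ?thesis
    unfolding design_def divide_inverse
    by (intro smooth_add smooth_diff smooth_mult smooth_uminus smooth_power smooth_const
        smooth_frechet_derivative smooth_ident P e coupling_smooth *)
qed

lemma smooth_U: "smooth (U k)"
proof (induction k rule: wf_induct_rule[OF wf_before])
  case (1 k)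
  then show ?case by (subst U_eq) (rule smooth_design)
qed

lemma smooth_Phi: "smooth (Phi U k)"
  by (rule Phi_smooth) (rule smooth_U)

lemma smooth_err: "smooth (err U k)"
  unfolding err_def by (intro smooth_diff smooth_vec_nth smooth_snd smooth_ident smooth_Phi)

section \<open>Triangular dependence of the virtual controls\<close>

lemma dep_Phi:
  assumes "\<And>k'. (k', k) \<in> before \<Longrightarrow> dep (lev k') (U k')"
  shows "dep (lev k - 1) (Phi U k)"
  using assms[OF prv_before] by (auto simp: Phi_def dep_def)

lemma dep_coupling:
  assumes "\<And>k'. (k', k) \<in> before \<Longrightarrow> dep (lev k') (U k')"
  shows "dep (lev k) (coupling U k)"
proof -
  have "U (lst l) (pr (lev k) x) = U (lst l) x" if "l < ch k" "q l \<le> lev k" for l x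
    using dep_pr[OF dep_mono[OF assms[OF lst_before[OF that]]], of "lev k"] that by simp
  moreover have "\<delta> (ch k) (lev k) l z (snd (pr (lev k) x)) = \<delta> (ch k) (lev k) l z (snd x)"
    if "l < ch k" "lev k < q (ch k)" for l z x
    using depends_only_up_to_pr[OF delta_dep[OF lev_ge_1 that(2,1)] lev_ge_1 order_refl] .
  ultimately show ?thesis
    unfolding dep_def coupling_def by (intro allI sum.cong) auto
qed

lemma dep_gain: "dep (lev k) (gain k)"
  by (simp add: dep_def gain_def pr_pr)

lemma dep_err:
  assumes "dep (lev k - 1) (Phi U k)"
  shows "dep (lev k) (err U k)"
  using dep_pr[OF dep_mono[OF assms, of "lev k"]] by (simp add: dep_def err_def snd_pr_nth)

text \<open>\<open>Phi U k\<close> sees only levels below \<open>lev k\<close> (just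
  \<open>z\<close> when the level is 1), and every other ingredient of \<open>design\<close> sees
  levels up to \<open>lev k\<close>, for \<open>coupling\<close> by the hypothesis on
  \<open>\<delta>\<close>. Derivatives add no dependence.\<close>

lemma dep_U: "dep (lev k) (U k)"
proof (induction k rule: wf_induct_rule[OF wf_before])
  case (1 k)
  have up: "h (pr (lev k) x) = h x" if "dep j h" "j \<le> lev k" for j x and h :: "_ \<Rightarrow> real"
    using dep_pr[OF dep_mono[OF that]] .
  have P: "dep (lev k) (Phi U k)"
    by (rule dep_mono[OF dep_Phi[OF 1]]) auto
  have Phi: "frechet_derivative (Phi U k) (at (pr (lev k) x)) v = frechet_derivative (Phi U k) (at x) v" for x v
    by (rule dep_frechet_derivative(1)[OF P smooth_Phi])
  have cross: "cross U k (pr (lev k) x) = cross U k x" for x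
  proof (cases "lev k = 1")
    case False
    have "dep (lev (prv k)) (err U (prv k))"
      by (rule dep_err[OF dep_Phi[OF 1[OF trans_before[OF _ prv_before[OF False]]]]])
    then show ?thesis
      using False by (simp add: cross_def up)
  qed (simp add: cross_def del: One_nat_def)
  have "xi_drift U k' (pr (lev k) x) = xi_drift U k' x" if "lev k' < lev k" for k' x
  proof -
    have "dep (lev k') (coupling U k')" "dep (lev k') (U k')"
      using that by (auto intro!: dep_coupling 1 simp: before_iff)
    then show ?thesis
      using that by (auto simp: xi_drift_def up snd_pr_nth)
  qed
  then have drift: "drift_below U (lev k) (pr (lev k) x) = drift_below U (lev k) x" for x
    using lev_ge_1 by (auto simp: drift_below_def vec_eq_iff)
  have gain: "err_gain U k (pr (lev k) x) = err_gain U k x" for x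
    unfolding err_gain_def by (simp add: up[OF dep_gain] Phi)
  show ?case
    unfolding dep_def
    by (subst (1 2) U_eq) (simp add: design_def cross drift gain Phi up[OF dep_coupling[OF 1]]
        up[OF dep_err[OF dep_Phi[OF 1]]])
qed

section \<open>Behaviour at the origin\<close>

lemma out_zero: "out 0 = 0"
  by (simp add: vec_eq_iff out_nth)

text \<open>Makes all errors vanish at the origin, which positive definiteness of the storage
  function requires. The derivative term drops out because the drift vanishes there and a derivative
  is linear.\<close>

lemma U_zero: "U k 0 = 0"
proof (induction k rule: wf_induct_rule[OF wf_before])
  case (1 k)
  have P: "Phi U k' 0 = 0" if "\<And>l. (l, k') \<in> before \<Longrightarrow> U l 0 = 0" for k'
    using that[OF prv_before] by (auto simp: Phi_def phi_zero)
  have "cross U k 0 = 0"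
    using P[OF 1[OF trans_before[OF _ prv_before]]] g_zero by (auto simp: cross_def err_def phi_zero out_zero)
  moreover have cp: "coupling U k' 0 = 0" if "lev k' < lev k \<or> k' = k" for k'
  proof -
    have "(lst l, k) \<in> before" if "l < ch k'" "q l \<le> lev k'" for l
      using trans_before[OF lst_before[OF that], of k] lst_before[OF that] \<open>lev k' < lev k \<or> k' = k\<close>
      by (auto simp: before_iff)
    then show ?thesis
      unfolding coupling_def by (intro sum.neutral) (simp add: 1)
  qed
  moreover have "drift_below U (lev k) 0 = 0"
  proof -
    have "xi_drift U k' 0 = 0" if "lev k' < lev k" for k'
      using that by (simp add: xi_drift_def cp 1 before_iff)
    then show ?thesis
      by (simp add: drift_below_def f0_zero out_zero vec_eq_iff prod_eq_iff)
  qed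
  moreover have "err U k 0 = 0"
    using P[OF 1] by (simp add: err_def)
  ultimately show ?case
    by (subst U_eq) (simp add: design_def linear_0[OF smooth_linear_frechet_derivative[OF smooth_Phi]])
qed

lemma Phi_zero: "Phi U k 0 = 0"
  by (simp add: Phi_def phi_zero U_zero)

section \<open>Error coordinates and storage functions\<close>

abbreviation "\<Phi> \<equiv> Phi U"
abbreviation "e \<equiv> err U"

lemma err_zero: "e k 0 = 0"
  by (simp add: err_def Phi_zero)

lemma has_derivative_err:
  "(e k has_derivative (\<lambda>h. snd h $ k - frechet_derivative (\<Phi> k) (at x) h)) (at x)"
  unfolding err_def
  by (intro has_derivative_diff smooth_has_derivative[OF smooth_Phi]
      bounded_linear_imp_has_derivative bounded_linear_compose[OF bounded_linear_vec_nth bounded_linear_snd])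

text \<open>The change to error coordinates is triangular: a coordinate is its error plus
  \<open>\<Phi> k\<close>, a continuous function of lower levels. By induction these range over a
  bounded set, whose closure is compact, so \<open>\<Phi> k\<close> is bounded there.\<close>

lemma bounded_if_errors_bounded:
  fixes K :: "('z \<times> (real ^ 'k)) set"
  assumes z: "bounded (fst ` K)" and e: "\<And>k. bounded (e k ` K)"
  shows "bounded K"
proof -
  have "bounded (pr j ` K)" for j
  proof (induction j)
    case 0
    have [simp]: "lev k \<noteq> 0" for k
      using lev_ge_1[of k] by simp
    have "pr 0 x = (fst x, 0)" for x
      by (simp add: pr_def vec_eq_iff)
    then have "pr 0 ` K \<subseteq> (fst ` K) \<times> {0}"
      by (simp add: image_subset_iff)
    moreover have "bounded ((fst ` K) \<times> {0 :: real ^ 'k})"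
      using z by (intro bounded_Times) simp_all
    ultimately show ?case
      by (rule bounded_subset[rotated])
  next
    case (Suc j)
    have "bounded ((\<lambda>x. snd x $ k) ` K)" if "lev k \<le> Suc j" for k
    proof -
      have "dep j (\<Phi> k)"
        by (rule dep_mono[OF dep_Phi[OF dep_U]]) (use that in simp)
      then have "\<Phi> k ` K = \<Phi> k ` (pr j ` K)"
        by (simp add: image_image dep_pr)
      moreover have "compact (\<Phi> k ` closure (pr j ` K))"
        using Suc by (intro compact_continuous_image smooth_imp_continuous_on smooth_Phi) simp
      then have "bounded (\<Phi> k ` (pr j ` K))"
        by (meson bounded_subset closure_subset compact_imp_bounded image_mono)
      ultimately have "bounded ((\<lambda>x. e k x + \<Phi> k x) ` K)"
        using e[of k] by (simp add: bounded_plus_comp)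
      then show ?thesis by (simp add: err_def)
    qed
    then have "\<exists>B. \<forall>x\<in>K. norm (snd (pr (Suc j) x) $ k) \<le> B" for k
      by (cases "lev k \<le> Suc j") (auto simp: snd_pr_nth bounded_iff)
    then obtain B where B: "\<And>k x. x \<in> K \<Longrightarrow> norm (snd (pr (Suc j) x) $ k) \<le> B k"
      by metis
    obtain C where C: "\<And>x. x \<in> K \<Longrightarrow> norm (fst x) \<le> C"
      using z by (auto simp: bounded_iff)
    have "norm (pr (Suc j) x) \<le> C + sum B UNIV" if "x \<in> K" for x
    proof -
      have "norm (pr (Suc j) x) \<le> norm (fst x) + norm (snd (pr (Suc j) x))"
        using norm_Pair_le[of "fst x" "snd (pr (Suc j) x)"] prod.collapse[of "pr (Suc j) x"] by simp
      moreover have "norm (snd (pr (Suc j) x)) \<le> sum B UNIV"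
        using B[OF that] by (intro order_trans[OF norm_le_l1_cart] sum_mono) simp
      ultimately show ?thesis using C[OF that] by simp
    qed
    then show ?case
      by (intro boundedI[where B = "C + sum B UNIV"]) (elim imageE, simp)
  qed
  \<comment> \<open>At the highest level that occurs, \<open>pr\<close> keeps every
    coordinate.\<close>
  from this[of "Max (range lev)"] show ?thesis
    by (simp add: pr_def)
qed

text \<open>Same triangular structure: once all lower levels vanish, so does the virtual control,
  and the coordinate equals its error.\<close>

lemma zero_if_errors_zero:
  assumes z: "fst x = 0" and e: "\<And>k. e k x = 0"
  shows "x = 0"
proof -
  have "snd x $ k = 0" for k
  proof (induction "lev k" arbitrary: k rule: less_induct)
    case less
    have "pr (lev k - 1) x = 0"
      using less lev_ge_1[of k] z by (auto simp: prod_eq_iff vec_eq_iff snd_pr_nth)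
    then have "\<Phi> k x = 0"
      using dep_pr[OF dep_Phi[OF dep_U], of k x] Phi_zero[of k] by simp
    then show ?case using e[of k] by (simp add: err_def)
  qed
  with z show ?thesis by (simp add: prod_eq_iff vec_eq_iff)
qed

definition errsq :: "'z \<times> (real ^ 'k) \<Rightarrow> real" where
  "errsq x = (\<Sum>k\<in>UNIV. (e k x)\<^sup>2)"

lemma smooth_errsq: "smooth errsq"
  unfolding errsq_def by (intro smooth_sum smooth_power smooth_err)

text \<open>Kept general in \<open>V\<close> and \<open>c\<close> because it serves twice: for the
  storage function, and for the decay rate with \<open>\<alpha>\<^sub>0 (norm z)\<close> in place of
  \<open>V z\<close>. The same holds for \<open>lyapunov_proper\<close>.\<close>

lemma lyapunov_pd:
  assumes "V 0 = 0" "\<And>z. z \<noteq> 0 \<Longrightarrow> V z > 0" "c > 0"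
  shows "positive_definite (\<lambda>x. V (fst x) + c * errsq x)"
proof -
  have nonneg: "V z \<ge> 0" "errsq x \<ge> 0" for z x
    using assms(1) assms(2)[of z] by (cases "z = 0", auto simp: errsq_def sum_nonneg)
  have "V (fst x) + c * errsq x > 0" if "x \<noteq> 0" for x
  proof (rule ccontr)
    assume "\<not> V (fst x) + c * errsq x > 0"
    moreover have "0 \<le> c * errsq x"
      using nonneg(2) \<open>c > 0\<close> by simp
    ultimately have "V (fst x) = 0" "c * errsq x = 0"
      using nonneg(1)[of "fst x"] by linarith+
    with \<open>c > 0\<close> have *: "V (fst x) = 0" "errsq x = 0" by simp_all
    from *(1) assms(2)[of "fst x"] have "fst x = 0" by auto
    moreover from *(2) have "e k x = 0" for k
      by (simp add: errsq_def sum_nonneg_eq_0_iff)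
    ultimately show False using zero_if_errors_zero that by blast
  qed
  then show ?thesis
    by (simp add: positive_definite_def assms(1) errsq_def err_zero)
qed

lemma lyapunov_proper:
  assumes "\<And>z. V z \<ge> 0" "radially_unbounded V" "c > 0"
  shows "radially_unbounded (\<lambda>x. V (fst x) + c * errsq x)"
  unfolding radially_unbounded_iff_bounded_sublevel
proof
  fix C
  define K where "K = {x. V (fst x) + c * errsq x \<le> C}"
  have esq: "(e k x)\<^sup>2 \<le> errsq x" for k x
    unfolding errsq_def by (rule member_le_sum) auto
  have nonneg: "errsq x \<ge> 0" for x
    by (simp add: errsq_def sum_nonneg)
  have "fst ` K \<subseteq> {z. V z \<le> C}"
  proof -
    have "V (fst x) \<le> C" if "x \<in> K" for x
    proof -
      have "0 \<le> c * errsq x" using nonneg \<open>c > 0\<close> by simp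
      with that show ?thesis by (simp add: K_def)
    qed
    then show ?thesis by auto
  qed
  then have "bounded (fst ` K)"
    using assms(2) unfolding radially_unbounded_iff_bounded_sublevel by (blast intro: bounded_subset)
  moreover have "bounded (e k ` K)" for k
  proof -
    have "\<bar>e k x\<bar> \<le> sqrt (C / c)" if "x \<in> K" for x
    proof -
      have "c * errsq x \<le> C"
        using that assms(1)[of "fst x"] by (simp add: K_def)
      then have "(e k x)\<^sup>2 \<le> C / c"
        using esq[of k x] \<open>c > 0\<close> by (simp add: pos_le_divide_eq mult.commute order_trans[OF mult_left_mono])
      then show ?thesis by (simp add: real_le_rsqrt)
    qed
    then show ?thesis
      by (intro boundedI[where B = "sqrt (C / c)"]) (elim imageE, simp)
  qed
  ultimately have "bounded K" by (rule bounded_if_errors_bounded)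
  then show "bounded {x. V (fst x) + c * errsq x \<le> C}" by (simp add: K_def)
qed

section \<open>Closed-loop vector field and size of the disturbance\<close>

definition field :: "'z \<times> (real ^ 'k) \<Rightarrow> real \<Rightarrow> 'z \<times> (real ^ 'k)" where
  "field = closed_loop q ix f\<^sub>0 p\<^sub>0 \<delta> p (\<lambda>i z \<xi>. U (lst i) (z, \<xi>))"

definition noise :: "'k \<Rightarrow> 'z \<times> (real ^ 'k) \<Rightarrow> real \<Rightarrow> real" where
  "noise k x w = p (ch k) (lev k) (fst x) (snd x) w"

lemma fst_field: "fst (field x w) = f\<^sub>0 (fst x) (out x) + p\<^sub>0 (fst x) w"
  by (simp add: field_def closed_loop_def out_def split_beta)

text \<open>Matches the system equations with the operators of the design: summands with
  \<open>lev k < q l\<close> vanish by \<open>delta_zero\<close>, and at the last level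
  \<open>lst (ch k)\<close> is \<open>k\<close> itself.\<close>

lemma snd_field_nth: "snd (field x w) $ k = xi_drift U k x + noise k x w"
proof -
  have "snd (field x w) $ ix (ch k) (lev k) =
      xi_rhs q ix \<delta> p (\<lambda>i. U (lst i) x) (fst x) (snd x) w (ch k) (lev k)"
    by (simp add: field_def closed_loop_def split_beta stack_nth[OF ix lev_ge_1 lev_le_q] del: ix_ch_lev)
  moreover have "(\<Sum>l\<in>{..<ch k}. \<delta> (ch k) (lev k) l (fst x) (snd x) * U (lst l) x) = coupling U k x"
    if "lev k < q (ch k)"
    unfolding coupling_def using that delta_zero[OF lev_ge_1[of k], of "ch k"]
    by (intro sum.mono_neutral_right) (auto simp flip: not_less)
  moreover have "lst (ch k) = k" if "\<not> lev k < q (ch k)"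
    using that lev_le_q[of k] ix_ch_lev[of k] by (simp add: lst_def)
  ultimately show ?thesis
    by (auto simp: xi_rhs_def xi_drift_def noise_def nxt_def)
qed

text \<open>\<open>p\<close> does not change under truncation of the state, so its bound may be
  evaluated at the truncated state, which gives a gain of level \<open>lev k\<close>.\<close>

lemma noise_bound: "\<bar>noise k x w\<bar> \<le> gain k x * \<bar>w\<bar>"
proof -
  have "noise k x w = p (ch k) (lev k) (fst x) (snd (pr (lev k) x)) w"
    using depends_only_up_to_pr[OF p_dep[OF lev_ge_1 lev_le_q, of k w] lev_ge_1 order_refl, of "fst x" x]
    by (simp add: noise_def)
  then show ?thesis
    using p_bound[OF lev_ge_1 lev_le_q, of k "fst x" "snd (pr (lev k) x)" w] by (simp add: gain_def)
qed

lemma gain_nonneg: "0 \<le> gain k x"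
  using noise_bound[of k x 1] by simp

lemma R0_nonneg: "0 \<le> R\<^sub>0 z"
  by (rule order_trans[OF norm_ge_zero p0_bound[of z 1, simplified]])

definition noise_below :: "nat \<Rightarrow> 'z \<times> (real ^ 'k) \<Rightarrow> real \<Rightarrow> 'z \<times> (real ^ 'k)" where
  "noise_below j x w = (p\<^sub>0 (fst x) w, \<chi> k. if lev k < j then noise k x w else 0)"

text \<open>Only this part of the velocity enters the rate of change of \<open>\<Phi> k\<close>: a
  known drift plus a disturbance.\<close>

lemma pr_field: "pr (lev k - 1) (field x w) = drift_below U (lev k) x + noise_below (lev k) x w"
proof -
  have "lev k' \<le> lev k - 1 \<longleftrightarrow> lev k' < lev k" for k'
    using lev_ge_1[of k] by linarith
  then show ?thesis
    by (auto simp: pr_def prod_eq_iff vec_eq_iff drift_below_def noise_below_def fst_field snd_field_nth)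
qed

definition rest :: "'k \<Rightarrow> 'z \<times> (real ^ 'k) \<Rightarrow> real \<Rightarrow> real" where
  "rest k x w = noise k x w - frechet_derivative (\<Phi> k) (at x) (noise_below (lev k) x w)"

text \<open>The derivative of \<open>\<Phi> k\<close> is expanded over the basis; each component of
  the lower disturbance is at most its norm, itself bounded by \<open>R\<^sub>0\<close> and the sum
  of the lower gains.\<close>

lemma rest_bound: "\<bar>rest k x w\<bar> \<le> err_gain U k x * \<bar>w\<bar>"
proof -
  let ?D = "frechet_derivative (\<Phi> k) (at x)" and ?n = "noise_below (lev k) x w"
  have "norm (snd ?n) \<le> (\<Sum>k'\<in>UNIV. \<bar>snd ?n $ k'\<bar>)"
    by (rule norm_le_l1_cart)
  also have "\<dots> = (\<Sum>k' | lev k' < lev k. \<bar>noise k' x w\<bar>)"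
    by (simp add: noise_below_def if_distrib[of abs] sum.If_cases cong: if_cong)
  also have "\<dots> \<le> (\<Sum>k' | lev k' < lev k. gain k' x * \<bar>w\<bar>)"
    by (intro sum_mono noise_bound)
  finally have "norm (snd ?n) \<le> (\<Sum>k' | lev k' < lev k. gain k' x) * \<bar>w\<bar>"
    by (simp add: sum_distrib_right)
  moreover have "norm ?n \<le> norm (p\<^sub>0 (fst x) w) + norm (snd ?n)"
    unfolding noise_below_def by (simp add: norm_Pair_le)
  ultimately have n: "norm ?n \<le> (R\<^sub>0 (fst x) + (\<Sum>k' | lev k' < lev k. gain k' x)) * \<bar>w\<bar>"
    using p0_bound[of "fst x" w] by (simp add: distrib_right)
  have "\<bar>?D ?n\<bar> = \<bar>\<Sum>b\<in>Basis. (?n \<bullet> b) *\<^sub>R ?D b\<bar>"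
    by (rule arg_cong[where f = abs, OF linear_basis_expansion[OF
          smooth_linear_frechet_derivative[OF smooth_Phi]]])
  also have "\<dots> \<le> (\<Sum>b\<in>Basis. norm ?n * (1 + (?D b)\<^sup>2))"
  proof (rule order_trans[OF sum_abs sum_mono])
    fix b :: "'z \<times> (real ^ 'k)" assume "b \<in> Basis"
    then have "\<bar>?n \<bullet> b\<bar> \<le> norm ?n" by (rule Basis_le_norm)
    moreover have "\<bar>?D b\<bar> \<le> 1 + (?D b)\<^sup>2"
    proof -
      have "0 \<le> (\<bar>?D b\<bar> - 1)\<^sup>2" by simp
      then show ?thesis by (simp add: power2_diff)
    qed
    ultimately show "\<bar>(?n \<bullet> b) *\<^sub>R ?D b\<bar> \<le> norm ?n * (1 + (?D b)\<^sup>2)"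
      by (simp add: abs_mult mult_mono)
  qed
  also have "\<dots> = (\<Sum>b\<in>Basis. 1 + (?D b)\<^sup>2) * norm ?n"
    by (simp add: sum_distrib_left mult.commute)
  also have "\<dots> \<le> (\<Sum>b\<in>Basis. 1 + (?D b)\<^sup>2) * ((R\<^sub>0 (fst x) + (\<Sum>k' | lev k' < lev k. gain k' x)) * \<bar>w\<bar>)"
    by (intro mult_left_mono n sum_nonneg) auto
  finally have "\<bar>?D ?n\<bar> \<le> (\<Sum>b\<in>Basis. 1 + (?D b)\<^sup>2) * (R\<^sub>0 (fst x) + (\<Sum>k' | lev k' < lev k. gain k' x)) * \<bar>w\<bar>"
    by (simp only: mult.assoc)
  with noise_bound[of k x w] show ?thesis
    unfolding rest_def err_gain_def distrib_right by linarith
qed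

section \<open>Error dynamics and cancellation\<close>

definition err_next :: "'k \<Rightarrow> 'z \<times> (real ^ 'k) \<Rightarrow> real" where
  "err_next k x = (if lev k < q (ch k) then e (nxt k) x else 0)"

text \<open>Below the last level the next coordinate is the virtual control plus its own error; at
  the last level the control is applied exactly and \<open>err_next\<close> is 0. Inserting
  \<open>design\<close> cancels the coupling and the known drift of \<open>\<Phi> k\<close>.\<close>

lemma err_dynamics:
  "snd (field x w) $ k - frechet_derivative (\<Phi> k) (at x) (field x w)
    = err_next k x - cross U k x - e k x * (2 + (err_gain U k x)\<^sup>2 / (4 * \<eta>)) + rest k x w"
proof -
  let ?D = "frechet_derivative (\<Phi> k) (at x)"
  have "?D (field x w) = ?D (pr (lev k - 1) (field x w))"
    using dep_frechet_derivative(2)[OF dep_Phi[OF dep_U] smooth_Phi] by simp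
  also have "\<dots> = ?D (drift_below U (lev k) x) + ?D (noise_below (lev k) x w)"
    unfolding pr_field by (rule linear_add[OF smooth_linear_frechet_derivative[OF smooth_Phi]])
  finally have D: "?D (field x w) = \<dots>" .
  have "xi_drift U k x = err_next k x + U k x + coupling U k x"
  proof (cases "lev k < q (ch k)")
    case True
    have "prv (nxt k) = k" "lev (nxt k) \<noteq> 1"
      using True lev_ge_1[of k] by (simp_all add: prv_def)
    then have "\<Phi> (nxt k) = U k" by (simp add: Phi_def)
    then show ?thesis
      using True by (simp add: xi_drift_def err_next_def err_def)
  qed (simp add: xi_drift_def err_next_def coupling_def)
  moreover have "U k x = design U k x"
    by (simp add: U_eq[symmetric])
  ultimately show ?thesis
    by (simp add: D snd_field_nth rest_def design_def)
qed

lemma err_rate: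
  "e k x * (snd (field x w) $ k - frechet_derivative (\<Phi> k) (at x) (field x w))
    \<le> e k x * err_next k x - e k x * cross U k x - 2 * (e k x)\<^sup>2 + \<eta> * w\<^sup>2"
proof -
  define s where "s = err_gain U k x"
  have "s \<ge> 0"
    unfolding s_def err_gain_def
    by (intro add_nonneg_nonneg mult_nonneg_nonneg gain_nonneg R0_nonneg sum_nonneg) auto
  have "e k x * rest k x w \<le> \<bar>e k x\<bar> * (s * \<bar>w\<bar>)"
    using mult_left_mono[OF rest_bound[of k x w], of "\<bar>e k x\<bar>"] abs_ge_self[of "e k x * rest k x w"]
    by (simp add: abs_mult s_def)
  also have "\<dots> \<le> \<eta> * w\<^sup>2 + (e k x)\<^sup>2 * s\<^sup>2 / (4 * \<eta>)"
  proof -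
    \<comment> \<open>Young's inequality by completing the square, weighted so that the error part
      is exactly the damping term of \<open>design\<close>.\<close>
    have "0 \<le> (2 * \<eta> * \<bar>w\<bar> - \<bar>e k x\<bar> * s)\<^sup>2" by simp
    also have "\<dots> = 4 * \<eta> * (\<eta> * w\<^sup>2 + (e k x)\<^sup>2 * s\<^sup>2 / (4 * \<eta>) - \<bar>e k x\<bar> * (s * \<bar>w\<bar>))"
      using eta_pos by (simp add: power2_diff power_mult_distrib) (simp add: field_simps power2_eq_square)
    finally show ?thesis using eta_pos by (simp add: zero_le_mult_iff)
  qed
  finally show ?thesis
    unfolding err_dynamics s_def[symmetric] by (simp add: algebra_simps power2_eq_square)
qed

text \<open>Telescoping: the product of \<open>e k\<close> with the next error is cancelled by the
  \<open>cross\<close> term of \<open>nxt k\<close>. The bijection between \<open>nxt\<close> and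
  \<open>prv\<close> matches all pairs, leaving only level 1.\<close>

lemma cross_terms:
  "(\<Sum>k\<in>UNIV. e k x * err_next k x - e k x * cross U k x)
    = - (\<Sum>i\<in>UNIV. e (ini i) x * (g i (fst x) (out x) + 2 * \<phi> i (fst x)))"
proof -
  have "(\<Sum>k\<in>UNIV. e k x * err_next k x) = (\<Sum>k | lev k < q (ch k). e k x * e (nxt k) x)"
    by (simp add: err_next_def sum.If_cases if_distrib[of "\<lambda>a. _ * a"] cong: if_cong)
  also have "\<dots> = (\<Sum>k | lev k \<noteq> 1. e (prv k) x * e k x)"
  proof (rule sum.reindex_bij_witness[of _ prv nxt])
    fix k assume "k \<in> {k. lev k < q (ch k)}"
    then show "prv (nxt k) = k" "nxt k \<in> {k. lev k \<noteq> 1}" "e (prv (nxt k)) x * e (nxt k) x = e k x * e (nxt k) x"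
      using lev_ge_1[of k] by (simp_all add: prv_def)
  next
    fix k assume "k \<in> {k. lev k \<noteq> 1}"
    then show "nxt (prv k) = k" "prv k \<in> {k. lev k < q (ch k)}"
      using lev_ge_1[of k] lev_le_q[of k] by (simp_all add: nxt_def)
  qed
  finally have 1: "(\<Sum>k\<in>UNIV. e k x * err_next k x) = (\<Sum>k | lev k \<noteq> 1. e (prv k) x * e k x)" .
  have "(\<Sum>k\<in>UNIV. e k x * cross U k x)
      = (\<Sum>k | lev k = 1. e k x * (g (ch k) (fst x) (out x) + 2 * \<phi> (ch k) (fst x)))
        + (\<Sum>k | lev k \<noteq> 1. e k x * e (prv k) x)"
    by (simp add: cross_def sum.If_cases if_distrib[of "\<lambda>a. _ * a"] Collect_neg_eq cong: if_cong)
  also have "(\<Sum>k | lev k = 1. e k x * (g (ch k) (fst x) (out x) + 2 * \<phi> (ch k) (fst x)))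
      = (\<Sum>i\<in>UNIV. e (ini i) x * (g i (fst x) (out x) + 2 * \<phi> i (fst x)))"
  proof (rule sum.reindex_bij_witness[of _ ini ch])
    fix k assume "k \<in> {k. lev k = 1}"
    then show "ini (ch k) = k"
      using ix_ch_lev[of k] by (simp add: ini_def)
    then show "e (ini (ch k)) x * (g (ch k) (fst x) (out x) + 2 * \<phi> (ch k) (fst x))
      = e k x * (g (ch k) (fst x) (out x) + 2 * \<phi> (ch k) (fst x))"
      by simp
  qed (auto simp del: One_nat_def)
  finally show ?thesis
    using 1 by (simp add: sum_subtractf mult.commute)
qed

section \<open>Dissipation inequality for the closed loop\<close>

lemma err_ini: "e (ini i) x = out x $ i - \<phi> i (fst x)"
  by (simp add: err_def Phi_def out_nth del: One_nat_def)

text \<open>Compared with the hypothesis at \<open>u = \<phi>(z)\<close>, the z-equation contributes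
  an extra sum of \<open>e * g\<close>, which \<open>cross\<close> cancels. Expanding the squared
  norm of \<open>y = \<phi> + e\<close> over level 1, the mixed term is supplied by
  \<open>2 * \<phi>\<close>, and the squares of the level 1 errors use up one of the two available
  copies of \<open>errsq\<close>.\<close>

lemma dissipation_estimate:
  assumes V: "smooth V"
    and diss: "\<And>z w. frechet_derivative V (at z) (f\<^sub>0 z (\<chi> i. \<phi> i z) + p\<^sub>0 z w)
           \<le> - a z + \<gamma>\<^sup>2 * (norm w)\<^sup>2 - (norm (\<chi> i. \<phi> i z))\<^sup>2"
    and g: "\<And>z u. frechet_derivative V (at z) (f\<^sub>0 z u) - frechet_derivative V (at z) (f\<^sub>0 z (\<chi> i. \<phi> i z))
           = (\<Sum>i\<in>UNIV. (u $ i - \<phi> i z) * g i z u)"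
  shows "frechet_derivative (\<lambda>x. V (fst x) + 1 / 2 * errsq x) (at x) (field x w)
    \<le> - (a (fst x) + errsq x) + (\<gamma>\<^sup>2 + CARD('k) * \<eta>) * w\<^sup>2 - (norm (out x))\<^sup>2"
proof -
  let ?z = "fst x" and ?F = "field x w"
  let ?dV = "frechet_derivative V (at ?z)"
  let ?u = "\<lambda>k. snd ?F $ k - frechet_derivative (\<Phi> k) (at x) ?F"
  have lin: "linear ?dV"
    by (rule smooth_linear_frechet_derivative[OF V])
  have "((\<lambda>x. (e k x)\<^sup>2) has_derivative
      (\<lambda>h. 2 * (snd h $ k - frechet_derivative (\<Phi> k) (at x) h) * e k x)) (at x)" for k
    by (rule has_derivative_eq_rhs[OF has_derivative_power[OF has_derivative_err]])
      (simp add: fun_eq_iff)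
  then have "((\<lambda>x. V (fst x) + 1 / 2 * errsq x) has_derivative (\<lambda>h. ?dV (fst h)
      + 1 / 2 * (\<Sum>k\<in>UNIV. 2 * (snd h $ k - frechet_derivative (\<Phi> k) (at x) h) * e k x))) (at x)"
    unfolding errsq_def
    by (intro has_derivative_add has_derivative_mult_right has_derivative_sum
        has_derivative_compose[OF has_derivative_fst[OF has_derivative_ident] smooth_has_derivative[OF V]])
  then have "frechet_derivative (\<lambda>x. V (fst x) + 1 / 2 * errsq x) (at x) ?F
      = ?dV (fst ?F) + 1 / 2 * (\<Sum>k\<in>UNIV. 2 * ?u k * e k x)"
    by (simp only: frechet_derivative_at[symmetric])
  also have "1 / 2 * (\<Sum>k\<in>UNIV. 2 * ?u k * e k x) = (\<Sum>k\<in>UNIV. e k x * ?u k)"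
    unfolding sum_distrib_left by (rule sum.cong) simp_all
  finally have rate: "frechet_derivative (\<lambda>x. V (fst x) + 1 / 2 * errsq x) (at x) ?F
      = ?dV (fst ?F) + (\<Sum>k\<in>UNIV. e k x * ?u k)" .
  have "(\<Sum>k\<in>UNIV. e k x * ?u k)
      \<le> (\<Sum>k\<in>UNIV. (e k x * err_next k x - e k x * cross U k x) - 2 * (e k x)\<^sup>2 + \<eta> * w\<^sup>2)"
    by (intro sum_mono err_rate)
  also have "\<dots> = (\<Sum>k\<in>UNIV. e k x * err_next k x - e k x * cross U k x) - 2 * errsq x
      + CARD('k) * \<eta> * w\<^sup>2"
    unfolding sum.distrib sum_subtractf[of _ "\<lambda>k. 2 * (e k x)\<^sup>2"] errsq_def sum_distrib_left by simp
  finally have rate_err: "(\<Sum>k\<in>UNIV. e k x * ?u k) \<le>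
      - (\<Sum>i\<in>UNIV. e (ini i) x * (g i ?z (out x) + 2 * \<phi> i ?z)) - 2 * errsq x
      + CARD('k) * \<eta> * w\<^sup>2"
    unfolding cross_terms .
  have rate_V: "?dV (fst ?F) = ?dV (f\<^sub>0 ?z (\<chi> i. \<phi> i ?z) + p\<^sub>0 ?z w)
      + (\<Sum>i\<in>UNIV. e (ini i) x * g i ?z (out x))"
    using g[of ?z "out x"] by (simp add: fst_field linear_add[OF lin] err_ini)
  have split: "(\<Sum>i\<in>UNIV. e (ini i) x * (g i ?z (out x) + 2 * \<phi> i ?z))
      = (\<Sum>i\<in>UNIV. e (ini i) x * g i ?z (out x)) + (\<Sum>i\<in>UNIV. 2 * \<phi> i ?z * e (ini i) x)"
    unfolding sum.distrib[symmetric] by (rule sum.cong) (simp_all add: algebra_simps)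
  have "(norm (out x))\<^sup>2 = (\<Sum>i\<in>UNIV. (\<phi> i ?z + e (ini i) x)\<^sup>2)"
    by (simp add: power2_norm_eq_inner inner_vec_def power2_eq_square[symmetric] err_ini)
  also have "\<dots> = (norm (\<chi> i. \<phi> i ?z))\<^sup>2 + (\<Sum>i\<in>UNIV. (e (ini i) x)\<^sup>2)
      + (\<Sum>i\<in>UNIV. 2 * \<phi> i ?z * e (ini i) x)"
    by (simp add: power2_norm_eq_inner inner_vec_def power2_eq_square[symmetric] power2_sum sum.distrib)
  finally have norm_out: "(norm (out x))\<^sup>2 = \<dots>" .
  have "inj ini" by (metis ini(1) injI)
  then have "(\<Sum>i\<in>UNIV. (e (ini i) x)\<^sup>2) = (\<Sum>k\<in>range ini. (e k x)\<^sup>2)"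
    by (simp add: sum.reindex)
  also have "\<dots> \<le> errsq x"
    unfolding errsq_def by (rule sum_mono2) auto
  finally have "(\<Sum>i\<in>UNIV. (e (ini i) x)\<^sup>2) \<le> errsq x" .
  with rate rate_err rate_V split norm_out diss[of ?z w] show ?thesis
    by (simp add: distrib_right)
qed

lemma strictly_dissipative_field:
  assumes V: "smooth V" "positive_definite V" "radially_unbounded V"
    and alpha0: "class_K_inf \<alpha>\<^sub>0"
    and diss: "\<And>z w. frechet_derivative V (at z) (f\<^sub>0 z (\<chi> i. \<phi> i z) + p\<^sub>0 z w)
           \<le> - \<alpha>\<^sub>0 (norm z) + \<gamma>\<^sup>2 * (norm w)\<^sup>2 - (norm (\<chi> i. \<phi> i z))\<^sup>2"
    and g: "\<And>z u. frechet_derivative V (at z) (f\<^sub>0 z u) - frechet_derivative V (at z) (f\<^sub>0 z (\<chi> i. \<phi> i z))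
           = (\<Sum>i\<in>UNIV. (u $ i - \<phi> i z) * g i z u)"
    and c: "\<gamma>\<^sup>2 + CARD('k) * \<eta> \<le> c"
  shows "strictly_dissipative field out (\<lambda>w y. c * (norm w)\<^sup>2 - (norm y)\<^sup>2)"
proof -
  have V0: "V z \<ge> 0" "V 0 = 0" "z \<noteq> 0 \<Longrightarrow> V z > 0" for z
    using V(2) by (cases "z = 0"; auto simp: positive_definite_def less_imp_le)+
  have alpha0_0: "\<alpha>\<^sub>0 0 = 0" and alpha0_less: "0 \<le> r \<Longrightarrow> r < s \<Longrightarrow> \<alpha>\<^sub>0 r < \<alpha>\<^sub>0 s" for r s
    using alpha0 by (auto simp: class_K_inf_def strict_mono_on_def)
  have alpha0_pos: "0 < r \<Longrightarrow> \<alpha>\<^sub>0 r > 0" for r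
    using alpha0_less[of 0 r] alpha0_0 by simp
  have alpha0_nonneg: "0 \<le> r \<Longrightarrow> \<alpha>\<^sub>0 r \<ge> 0" for r
    using alpha0_pos[of r] alpha0_0 by (cases "r = 0") auto
  define W where "W x = V (fst x) + 1 / 2 * errsq x" for x
  \<comment> \<open>The decay rate given by \<open>dissipation_estimate\<close>; the explicit weight
    1 fits the form of \<open>lyapunov_pd\<close> and \<open>lyapunov_proper\<close>.\<close>
  define Q where "Q x = \<alpha>\<^sub>0 (norm (fst x)) + 1 * errsq x" for x
  have "continuous_on UNIV (\<lambda>x :: 'z \<times> (real ^ 'k). \<alpha>\<^sub>0 (norm (fst x)))"
    by (rule continuous_on_compose2[of "{0..}" \<alpha>\<^sub>0])
      (use alpha0 in \<open>auto simp: class_K_inf_def intro!: continuous_intros\<close>)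
  then have "continuous_on UNIV Q"
    unfolding Q_def by (simp add: continuous_on_add smooth_imp_continuous_on smooth_errsq)
  moreover have "positive_definite Q"
    unfolding Q_def by (intro lyapunov_pd) (auto simp: alpha0_0 alpha0_pos)
  moreover have "radially_unbounded Q"
    unfolding Q_def
  proof (rule lyapunov_proper)
    show "radially_unbounded (\<lambda>z. \<alpha>\<^sub>0 (norm z))"
      unfolding radially_unbounded_iff_bounded_sublevel
    proof
      fix C
      obtain r where r: "r \<ge> 0" "\<alpha>\<^sub>0 r > C"
        using alpha0 by (force simp: class_K_inf_def bdd_above_def not_le)
      have "norm z \<le> r" if "\<alpha>\<^sub>0 (norm z) \<le> C" for z
      proof (rule ccontr)
        assume "\<not> norm z \<le> r"
        then have "\<alpha>\<^sub>0 r < \<alpha>\<^sub>0 (norm z)"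
          using alpha0_less r(1) by simp
        with r(2) that show False by simp
      qed
      then show "bounded {z. \<alpha>\<^sub>0 (norm z) \<le> C}"
        by (intro boundedI[where B = r]) auto
    qed
  qed (auto simp: alpha0_nonneg)
  ultimately obtain \<alpha> where \<alpha>: "class_K_inf \<alpha>" "\<And>x. \<alpha> (norm x) \<le> Q x"
    using class_K_inf_minorant by blast
  have "smooth W"
    unfolding W_def
    by (intro smooth_add smooth_mult smooth_const smooth_errsq smooth_compose[OF V(1)] smooth_fst smooth_ident)
  moreover have "positive_definite W"
    unfolding W_def by (intro lyapunov_pd V0) auto
  moreover have "radially_unbounded W"
    unfolding W_def by (intro lyapunov_proper V0 V(3)) auto
  moreover have "frechet_derivative W (at x) (field x w)
      \<le> - \<alpha> (norm x) + (c * (norm w)\<^sup>2 - (norm (out x))\<^sup>2)" for x w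
  proof -
    have "frechet_derivative W (at x) (field x w)
        \<le> - Q x + (\<gamma>\<^sup>2 + CARD('k) * \<eta>) * w\<^sup>2 - (norm (out x))\<^sup>2"
      using dissipation_estimate[of V "\<lambda>z. \<alpha>\<^sub>0 (norm z)" \<gamma> x w, OF V(1) diss g]
      unfolding W_def Q_def by simp
    moreover have "(\<gamma>\<^sup>2 + CARD('k) * \<eta>) * w\<^sup>2 \<le> c * w\<^sup>2"
      using c by (intro mult_right_mono) auto
    ultimately show ?thesis
      using \<alpha>(2)[of x] by simp
  qed
  ultimately show ?thesis
    using \<alpha>(1) unfolding strictly_dissipative_def by blast
qed

end

section \<open>Choice of the Hadamard coefficients and of the Young weight\<close>

theorem theorem6p3p1:
  fixes q :: "'m::{finite,linorder} \<Rightarrow> nat"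
    and ix :: "'m \<Rightarrow> nat \<Rightarrow> 'k::finite"
    and f\<^sub>0 :: "'z::euclidean_space \<Rightarrow> real ^ 'm::{finite,linorder} \<Rightarrow> 'z"
    and p\<^sub>0 :: "'z \<Rightarrow> real \<Rightarrow> 'z"
    and \<delta> :: "'m \<Rightarrow> nat \<Rightarrow> 'm \<Rightarrow> 'z \<Rightarrow> real ^ 'k \<Rightarrow> real"
    and p :: "'m \<Rightarrow> nat \<Rightarrow> 'z \<Rightarrow> real ^ 'k \<Rightarrow> real \<Rightarrow> real"
    and R\<^sub>0 :: "'z \<Rightarrow> real"
    and R :: "'m \<Rightarrow> nat \<Rightarrow> 'z \<Rightarrow> real ^ 'k \<Rightarrow> real"
    and \<gamma> :: real
    and \<phi> :: "'m \<Rightarrow> 'z \<Rightarrow> real"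
    and V :: "'z \<Rightarrow> real"
    and \<alpha>\<^sub>0 :: "real \<Rightarrow> real"
  assumes q_pos: "\<And>i. 1 \<le> q i"
    and q_mono: "mono q"
    and ix: "block_indexing q ix"
    and smooth_f0: "smooth (\<lambda>(z, u). f\<^sub>0 z u)"
    and f0_zero: "f\<^sub>0 0 0 = 0"
    and smooth_p0: "smooth (\<lambda>(z, w). p\<^sub>0 z w)"
    and smooth_delta: "\<And>i j l. \<lbrakk>1 \<le> j; j < q i; l < i\<rbrakk> \<Longrightarrow> smooth (\<lambda>(z, \<xi>). \<delta> i j l z \<xi>)"
    and smooth_p: "\<And>i j. \<lbrakk>1 \<le> j; j \<le> q i\<rbrakk> \<Longrightarrow> smooth (\<lambda>(z, \<xi>, w). p i j z \<xi> w)"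
    and delta_zero: "\<And>i j l z \<xi>. \<lbrakk>1 \<le> j; j < q i; l < i; j < q l\<rbrakk> \<Longrightarrow> \<delta> i j l z \<xi> = 0"
    and smooth_R0: "smooth R\<^sub>0"
    and smooth_R: "\<And>i j. \<lbrakk>1 \<le> j; j \<le> q i\<rbrakk> \<Longrightarrow> smooth (\<lambda>(z, \<xi>). R i j z \<xi>)"
    and p0_bound: "\<And>z w. norm (p\<^sub>0 z w) \<le> R\<^sub>0 z * norm w"
    and p_bound: "\<And>i j z \<xi> w. \<lbrakk>1 \<le> j; j \<le> q i\<rbrakk> \<Longrightarrow> \<bar>p i j z \<xi> w\<bar> \<le> R i j z \<xi> * norm w"
    and gamma_pos: "\<gamma> > 0"
    and smooth_phi: "\<And>i. smooth (\<phi> i)"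
    and phi_zero: "\<And>i. \<phi> i 0 = 0"
    and V: "smooth V" "positive_definite V" "radially_unbounded V"
    and alpha0: "class_K_inf \<alpha>\<^sub>0"
    and dissipation: "\<And>z w. frechet_derivative V (at z) (f\<^sub>0 z (\<chi> i. \<phi> i z) + p\<^sub>0 z w)
           \<le> - \<alpha>\<^sub>0 (norm z) + \<gamma>\<^sup>2 * (norm w)\<^sup>2 - (norm (\<chi> i. \<phi> i z))\<^sup>2"
    and delta_dep: "\<And>i j l. \<lbrakk>1 \<le> j; j < q i; l < i\<rbrakk> \<Longrightarrow> depends_only_up_to q ix i j (\<delta> i j l)"
    and p_dep: "\<And>i j w. \<lbrakk>1 \<le> j; j \<le> q i\<rbrakk> \<Longrightarrow> depends_only_up_to q ix i j (\<lambda>z \<xi>. p i j z \<xi> w)"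
  shows "\<forall>\<epsilon>>0. \<exists>v :: 'm \<Rightarrow> 'z \<Rightarrow> real ^ 'k \<Rightarrow> real.
           (\<forall>i. smooth (\<lambda>(z, \<xi>). v i z \<xi>)) \<and>
           strictly_dissipative (closed_loop q ix f\<^sub>0 p\<^sub>0 \<delta> p v) (\<lambda>(z, \<xi>). output_map ix \<xi>)
             (\<lambda>w y. (\<gamma> + \<epsilon>)\<^sup>2 * (norm w)\<^sup>2 - (norm y)\<^sup>2)"
proof (intro allI impI)
  fix \<epsilon> :: real assume "\<epsilon> > 0"
  \<comment> \<open>One Young term per coordinate costs \<open>\<epsilon>\<^sup>2\<close> in total,
    and \<open>\<gamma>\<^sup>2 + \<epsilon>\<^sup>2\<close> is at most
    \<open>(\<gamma> + \<epsilon>)\<^sup>2\<close>.\<close>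
  define \<eta> where "\<eta> = \<epsilon>\<^sup>2 / CARD('k)"
  have eta: "\<eta> > 0" "CARD('k) * \<eta> = \<epsilon>\<^sup>2"
    using \<open>\<epsilon> > 0\<close> by (simp_all add: \<eta>_def)
  have V0: "V z \<ge> 0" "V 0 = 0" "z \<noteq> 0 \<Longrightarrow> V z > 0" for z
    using V(2) by (cases "z = 0"; auto simp: positive_definite_def less_imp_le)+
  define H where "H = (\<lambda>(z, u). frechet_derivative V (at z) (f\<^sub>0 z u))"
  have smooth_H: "smooth H"
    unfolding H_def split_beta
    by (intro smooth_frechet_derivative V smooth_fst smooth_snd smooth_ident smooth_compose2[OF smooth_f0])
  obtain G where G: "\<And>b. smooth (G b)"
      "\<And>x y. H y - H x = (\<Sum>b\<in>Basis. ((y - x) \<bullet> b) * G b (x, y))"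
      "\<And>b x. G b (x, x) = frechet_derivative H (at x) b"
    using smooth_Hadamard[OF smooth_H] by blast
  \<comment> \<open>The two points compared share the component \<open>z\<close>, so only the basis
    directions of the input space contribute to the Hadamard sum.\<close>
  define g where "g i z u = G (0, axis i 1) ((z, \<chi> i. \<phi> i z), (z, u))" for i z u
  have smooth_g: "smooth (\<lambda>(z, u). g i z u)" for i
    unfolding g_def split_beta
    by (intro smooth_compose[OF G(1)] smooth_Pair smooth_vec_lambda smooth_compose[OF smooth_phi]
        smooth_fst smooth_snd smooth_ident)
  have g_eq: "frechet_derivative V (at z) (f\<^sub>0 z u) - frechet_derivative V (at z) (f\<^sub>0 z (\<chi> i. \<phi> i z))
      = (\<Sum>i\<in>UNIV. (u $ i - \<phi> i z) * g i z u)" for z u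
  proof -
    let ?a = "(z, \<chi> i. \<phi> i z)" and ?b = "(z, u)"
    have "H ?b - H ?a = (\<Sum>b\<in>Basis. ((?b - ?a) \<bullet> b) * G b (?a, ?b))"
      by (rule G(2))
    also have "\<dots> = (\<Sum>b\<in>Basis. ((u - (\<chi> i. \<phi> i z)) \<bullet> b) * G (0, b) (?a, ?b))"
      unfolding Basis_prod_def by (subst sum.union_disjoint) (auto simp: sum.reindex inj_on_def nonzero_Basis)
    also have "(Basis :: (real ^ 'm::{finite,linorder}) set) = range (\<lambda>i. axis i 1)"
      by (auto simp: Basis_vec_def)
    also have "(\<Sum>b\<in>range (\<lambda>i. axis i 1). ((u - (\<chi> i. \<phi> i z)) \<bullet> b) * G (0, b) (?a, ?b))
        = (\<Sum>i\<in>UNIV. (u $ i - \<phi> i z) * g i z u)"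
      by (subst sum.reindex) (auto simp: inj_on_def axis_eq_axis inner_axis g_def)
    finally show ?thesis by (simp add: H_def)
  qed
  \<comment> \<open>\<open>V\<close> has its minimum at 0, so its derivative there vanishes and
    \<open>H (0, u) = 0\<close> for every \<open>u\<close>. Because \<open>\<phi>\<close> vanishes
    at 0, \<open>g i 0 0\<close> is a diagonal value of \<open>G\<close>, namely a partial
    derivative of \<open>H\<close> in a \<open>u\<close> direction at the origin.\<close>
  have g_zero: "g i 0 0 = 0" for i
  proof -
    have "frechet_derivative V (at 0) = (\<lambda>v. 0)"
      by (rule differential_zero_maxmin[OF _ open_UNIV smooth_has_derivative[OF V(1)]]) (use V0 in auto)
    then have "H (0, u) = 0" for u
      by (simp add: H_def)
    moreover have "((\<lambda>u. H (0, u)) has_derivative (\<lambda>v. frechet_derivative H (at (0, 0)) (0, v))) (at 0)"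
      by (rule has_derivative_compose[OF _ smooth_has_derivative[OF smooth_H]])
        (auto intro!: derivative_eq_intros)
    ultimately have "((\<lambda>u. 0) has_derivative (\<lambda>v. frechet_derivative H (at (0, 0)) (0, v))) (at (0 :: real ^ 'm::{finite,linorder}))"
      by (simp only:)
    then have "(\<lambda>v. frechet_derivative H (at (0, 0)) (0, v)) = (\<lambda>v. 0)"
      by (rule has_derivative_unique[OF _ has_derivative_const])
    moreover have "(\<chi> i. \<phi> i 0) = 0"
      by (simp add: vec_eq_iff phi_zero)
    moreover have "g i 0 0 = G (0, axis i 1) ((0, \<chi> i. \<phi> i 0), (0, 0))"
      by (simp only: g_def)
    ultimately show ?thesis
      using fun_cong[of "\<lambda>v. frechet_derivative H (at (0, 0)) (0, v)" "\<lambda>v. 0" "axis i 1"]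
      by (simp only: G(3))
  qed
  interpret backstepping q ix f\<^sub>0 p\<^sub>0 \<delta> p R\<^sub>0 R \<phi> g \<eta>
    by (intro backstepping.intro q_pos ix smooth_f0 f0_zero smooth_delta delta_zero smooth_R0 smooth_R
        p0_bound p_bound smooth_phi phi_zero delta_dep p_dep smooth_g g_zero eta(1))
  have "\<gamma>\<^sup>2 + CARD('k) * \<eta> \<le> (\<gamma> + \<epsilon>)\<^sup>2"
    using gamma_pos \<open>\<epsilon> > 0\<close> eta(2) by (simp add: power2_sum)
  then have "strictly_dissipative field out (\<lambda>w y. (\<gamma> + \<epsilon>)\<^sup>2 * (norm w)\<^sup>2 - (norm y)\<^sup>2)"
    by (rule strictly_dissipative_field[OF V alpha0 dissipation g_eq])
  moreover have "out = (\<lambda>(z, \<xi>). output_map ix \<xi>)"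
    by (auto simp: out_def)
  moreover have "smooth (\<lambda>(z, \<xi>). U (lst i) (z, \<xi>))" for i
    using smooth_U[of "lst i"] by simp
  ultimately show "\<exists>v :: 'm \<Rightarrow> 'z \<Rightarrow> real ^ 'k \<Rightarrow> real.
           (\<forall>i. smooth (\<lambda>(z, \<xi>). v i z \<xi>)) \<and>
           strictly_dissipative (closed_loop q ix f\<^sub>0 p\<^sub>0 \<delta> p v) (\<lambda>(z, \<xi>). output_map ix \<xi>)
             (\<lambda>w y. (\<gamma> + \<epsilon>)\<^sup>2 * (norm w)\<^sup>2 - (norm y)\<^sup>2)"
    unfolding field_def by (intro exI[of _ "\<lambda>i z \<xi>. U (lst i) (z, \<xi>)"]) simp
qed

end
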